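(* Let $k \geq 4$ be an integer and let $\pi = (d_1, \ldots, d_n)$ be a sequence of nonnegative integers with $n$ even. Suppose that both $\pi$ and $\pi - k = (d_1 - k, \ldots, d_n - k)$ are graphic. Then there is a simple graph $G$ realizing $\pi$ that contains pairwise edge-disjoint spanning subgraphs $F_0, F_1, F_2, F_3, F_4$, where $F_0$ is a $(k-4)$-factor of $G$ and each of $F_1, F_2, F_3, F_4$ is a $1$-factor (perfect matching) of $G$.
   Context: A sequence $\pi = (d_1, \ldots, d_n)$ of nonnegative integers is graphic if there is a simple graph $G$ on vertex set $\{v_1,\dots,v_n\}$ with $\deg_G(v_i) = d_i$ for all $i$; such a $G$ is said to realize $\pi$. For an integer $k$, $\pi - k$ denotes the sequence $(d_1 - k, \ldots, d_n - k)$. A $j$-factor of a graph $G$ is a spanning $j$-regular subgraph of $G$; a $1$-factor is a perfect matching. *)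

theory Defs
  imports Main "HOL-Library.Disjoint_Sets"
begin

type_synonym 'a ugraph = "'a set \<times> 'a set set"

abbreviation verts :: "'a ugraph \<Rightarrow> 'a set" where
  "verts G \<equiv> fst G"

abbreviation edges :: "'a ugraph \<Rightarrow> 'a set set" where
  "edges G \<equiv> snd G"

definition simple_graph :: "'a ugraph \<Rightarrow> bool" where
  "simple_graph G \<longleftrightarrow> finite (verts G) \<and> edges G \<subseteq> {e. e \<subseteq> verts G \<and> card e = 2}"

definition degree :: "'a ugraph \<Rightarrow> 'a \<Rightarrow> nat" where
  "degree G v = card {e \<in> edges G. v \<in> e}"

definition regular :: "nat \<Rightarrow> 'a ugraph \<Rightarrow> bool" where
  "regular j G \<longleftrightarrow> (\<forall>v \<in> verts G. degree G v = j)"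

definition spanning_subgraph :: "'a ugraph \<Rightarrow> 'a ugraph \<Rightarrow> bool" where
  "spanning_subgraph F G \<longleftrightarrow> simple_graph F \<and> verts F = verts G \<and> edges F \<subseteq> edges G"

definition factor :: "nat \<Rightarrow> 'a ugraph \<Rightarrow> 'a ugraph \<Rightarrow> bool" where
  "factor j F G \<longleftrightarrow> spanning_subgraph F G \<and> regular j F"

text \<open>Sequences are integer lists, so that subtracting a constant from every entry does not
  truncate at zero; a realizable sequence is automatically nonnegative. The vertices are the
  list positions, i.e. the informal \<open>v\<^sub>1, \<dots>, v\<^sub>n\<close> are \<open>0, \<dots>, n - 1\<close>.\<close>

definition realizes :: "nat ugraph \<Rightarrow> int list \<Rightarrow> bool" where
  "realizes G ds \<longleftrightarrow> simple_graph G \<and> verts G = {..<length ds} \<and>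
     (\<forall>i < length ds. int (degree G i) = ds ! i)"

definition graphic :: "int list \<Rightarrow> bool" where
  "graphic ds \<longleftrightarrow> (\<exists>G. realizes G ds)"

definition seq_minus :: "int list \<Rightarrow> nat \<Rightarrow> int list" where
  "seq_minus ds k = map (\<lambda>d. d - int k) ds"

end

theory Submission
  imports Defs "HOL-Combinatorics.Cycles" "HOL-Library.Transitive_Closure_Table"
begin

text \<open>By Kundu's theorem there is a realization with a \<open>k\<close>-factor; perfect matchings are split off
  from the factor one at a time. View the graph minus its factors \<open>H\<close>, the complement \<open>N\<close>, the
  remaining regular factor \<open>F\<close> and the matchings found so far as colours of the complete graph. For
  vertices \<open>x\<close>, \<open>y\<close> every other vertex \<open>z\<close> gives an arc from the colour of \<open>xz\<close> to the colour of
  \<open>yz\<close>; exchanging the two colours for all \<open>z\<close> on a directed circuit preserves all degrees.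

  By Hall's theorem \<open>F\<close> has a spanning family of disjoint edges and odd cycles. Two odd cycles can be
  merged by such a switch unless, for an edge \<open>xx'\<close> of the first and a vertex \<open>y\<close> of the second, the
  colour of \<open>yx'\<close> does not reach \<open>F\<close>. Counting arcs, this forces \<open>x\<close> to have smaller
  \<open>H\<close>-degree than \<open>y\<close> if that colour is \<open>H\<close>, and larger if it is \<open>N\<close>. Hence if the \<open>H\<close>-degrees on an edge of one cycle all lay below those on an edge of the other, then the four
  edges joining them would have four different matching colours, but there are at most three. So
  the degree ranges of any two such edges overlap, which is impossible as neither cycle is
  bipartite.\<close>

section \<open>Marriage, matchings and cycles of permutations\<close>

text \<open>Induction in the style of Halmos and Vaughan. If some proper nonempty \<open>X\<close>
  is tight, \<open>X\<close> and its complement are matched separately, the latter avoiding all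
  neighbours of \<open>X\<close>. Otherwise each such set has a spare neighbour, so one vertex
  \<open>v\<close> may be given any partner \<open>y\<close>.\<close>

lemma hall_marriage:
  assumes "finite V" and "\<And>u. u \<in> V \<Longrightarrow> finite (N u)"
    and "\<And>X. X \<subseteq> V \<Longrightarrow> card X \<le> card (\<Union>u\<in>X. N u)"
  shows "\<exists>f. inj_on f V \<and> (\<forall>u\<in>V. f u \<in> N u)"
  using assms
proof (induction "card V" arbitrary: V N rule: less_induct)
  case less
  note fin = less.prems(1) and finN = less.prems(2) and hall = less.prems(3)
  show ?case
  proof (cases "V = {}")
    case True
    then show ?thesis by simp
  next
    case False
    show ?thesis
    proof (cases "\<exists>X. X \<subset> V \<and> X \<noteq> {} \<and> card (\<Union>u\<in>X. N u) = card X")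
      case True
      then obtain X where X: "X \<subset> V" "X \<noteq> {}" "card (\<Union>u\<in>X. N u) = card X"
        by blast
      let ?NX = "\<Union>u\<in>X. N u"
      have finX: "finite X" using X(1) fin finite_subset by blast
      have "card X < card V" using X(1) fin psubset_card_mono by blast
      then have "\<exists>f. inj_on f X \<and> (\<forall>u\<in>X. f u \<in> N u)"
        using X(1) by (intro less.hyps finX finN hall) auto
      then obtain f where f: "inj_on f X" "\<forall>u\<in>X. f u \<in> N u" by blast
      have "card (V - X) < card V"
        using X(1,2) fin by (intro psubset_card_mono) auto
      moreover have "card Y \<le> card (\<Union>u\<in>Y. N u - ?NX)" if Y: "Y \<subseteq> V - X" for Y
      proof -
        have finY: "finite Y" using Y fin finite_subset by blast
        have "card X + card Y = card (X \<union> Y)"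
          using Y finX finY by (subst card_Un_disjoint) auto
        also have "\<dots> \<le> card (\<Union>u\<in>X \<union> Y. N u)"
          using Y X(1) by (intro hall) auto
        also have "(\<Union>u\<in>X \<union> Y. N u) = ?NX \<union> (\<Union>u\<in>Y. N u - ?NX)" by auto
        also have "card \<dots> \<le> card ?NX + card (\<Union>u\<in>Y. N u - ?NX)"
          by (rule card_Un_le)
        finally show ?thesis using X(3) by simp
      qed
      ultimately have "\<exists>g. inj_on g (V - X) \<and> (\<forall>u\<in>V - X. g u \<in> N u - ?NX)"
        using fin finN by (intro less.hyps) auto
      then obtain g where g: "inj_on g (V - X)" "\<forall>u\<in>V - X. g u \<in> N u - ?NX" by blast
      let ?k = "\<lambda>u. if u \<in> X then f u else g u"
      have "inj_on ?k V"
        unfolding inj_on_def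
      proof (intro ballI impI)
        fix u v assume uv: "u \<in> V" "v \<in> V" "?k u = ?k v"
        have "f a \<noteq> g b" if "a \<in> X" "b \<in> V - X" for a b
          using that f(2) g(2) by force
        then show "u = v"
          using uv f(1) g(1) unfolding inj_on_def by (auto split: if_splits) metis+
      qed
      moreover have "\<forall>u\<in>V. ?k u \<in> N u" using f(2) g(2) by auto
      ultimately show ?thesis by (intro exI[of _ ?k]) blast
    next
      case strict: False
      obtain v where v: "v \<in> V" using False by blast
      have "card {v} \<le> card (\<Union>u\<in>{v}. N u)" using v by (intro hall) auto
      then obtain y where y: "y \<in> N v" by fastforce
      have "card X \<le> card (\<Union>u\<in>X. N u - {y})" if X: "X \<subseteq> V - {v}" for X
      proof (cases "X = {}")
        case False
        have "card X \<noteq> card (\<Union>u\<in>X. N u)" using strict X v False by (metis Diff_empty psubsetI subset_Diff_insert)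
        moreover have "card X \<le> card (\<Union>u\<in>X. N u)" using X by (intro hall) auto
        moreover have "card (\<Union>u\<in>X. N u) - 1 \<le> card ((\<Union>u\<in>X. N u) - {y})"
          by (simp add: card_Diff_singleton_if)
        ultimately have "card X \<le> card ((\<Union>u\<in>X. N u) - {y})" by linarith
        also have "(\<Union>u\<in>X. N u) - {y} = (\<Union>u\<in>X. N u - {y})" by auto
        finally show ?thesis .
      qed simp
      then have "\<exists>g. inj_on g (V - {v}) \<and> (\<forall>u\<in>V - {v}. g u \<in> N u - {y})"
        by (intro less.hyps) (use fin finN v in \<open>simp_all add: card_Diff1_less del: card_Diff_insert\<close>)
      then obtain g where g: "inj_on g (V - {v})" "\<forall>u\<in>V - {v}. g u \<in> N u - {y}" by blast
      have "inj_on (g(v := y)) (insert v (V - {v}))"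
        using g by (auto simp: inj_on_def)
      moreover have "insert v (V - {v}) = V" using v by auto
      ultimately show ?thesis
        using g y by (intro exI[of _ "g(v := y)"]) auto
    qed
  qed
qed

text \<open>A perfect matching of \<open>E\<close> on \<open>B\<close>, encoded as a
  fixed-point-free involution so that it can replace part of a permutation.\<close>

definition matching_on :: "('a \<Rightarrow> 'a \<Rightarrow> bool) \<Rightarrow> 'a set \<Rightarrow> ('a \<Rightarrow> 'a) \<Rightarrow> bool" where
  "matching_on E B \<tau> \<longleftrightarrow> (\<forall>u\<in>B. \<tau> u \<in> B \<and> \<tau> u \<noteq> u \<and> \<tau> (\<tau> u) = u \<and> E u (\<tau> u))"

lemma matching_on_path:
  assumes inj: "inj_on v {..<2 * m}" and sym: "\<And>a b. E a b \<Longrightarrow> E b a"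
    and E: "\<And>i. Suc i < 2 * m \<Longrightarrow> E (v i) (v (Suc i))"
  shows "\<exists>\<tau>. matching_on E (v ` {..<2 * m}) \<tau>"
proof -
  \<comment> \<open>Positions \<open>2i\<close> and \<open>2i + 1\<close> on the path are
    partners.\<close>
  define g :: "nat \<Rightarrow> nat" where "g i = (if even i then Suc i else i - 1)" for i
  define \<tau> where "\<tau> u = v (g (inv_into {..<2 * m} v u))" for u
  have g: "g i < 2 * m" "g (g i) = i" "g i \<noteq> i" if "i < 2 * m" for i
  proof -
    show "g i < 2 * m" using that by (cases "even i") (auto simp: g_def elim!: evenE)
    show "g (g i) = i" "g i \<noteq> i" by (auto simp: g_def elim!: oddE)
  qed
  have \<tau>: "\<tau> (v i) = v (g i)" if "i < 2 * m" for i
    using that inj by (simp add: \<tau>_def)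
  have "E (v i) (v (g i))" if i: "i < 2 * m" for i
  proof (cases "even i")
    case True
    then show ?thesis using E[of i] g(1)[OF i] by (simp add: g_def)
  next
    case False
    then have "Suc (g i) = i" by (auto simp: g_def elim!: oddE)
    then show ?thesis using E[of "g i"] i sym by metis
  qed
  then have "matching_on E (v ` {..<2 * m}) \<tau>"
    unfolding matching_on_def using \<tau> g inj by (auto simp: inj_on_eq_iff)
  then show ?thesis by blast
qed

text \<open>The pairs \<open>{u, \<tau> u}\<close> partition \<open>B\<close>.\<close>

lemma even_card_matching_on:
  assumes fin: "finite B" and m: "matching_on E B \<tau>"
  shows "even (card B)"
proof -
  let ?C = "(\<lambda>u. {u, \<tau> u}) ` B"
  have B: "\<Union>?C = B" using m by (auto simp: matching_on_def)
  have "2 dvd card (\<Union>?C)"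
  proof (rule dvd_partition)
    show "finite (\<Union>?C)" using B fin by simp
    show "\<forall>c\<in>?C. 2 dvd card c" using m by (force simp: matching_on_def)
    show "\<forall>c1\<in>?C. \<forall>c2\<in>?C. c1 \<noteq> c2 \<longrightarrow> c1 \<inter> c2 = {}"
      using m unfolding matching_on_def by (auto, metis+)
  qed
  then show ?thesis using B by simp
qed

section \<open>Cycles of a permutation as orbits\<close>

definition orb :: "('a \<Rightarrow> 'a) \<Rightarrow> 'a \<Rightarrow> 'a set" where
  "orb \<sigma> x = range (\<lambda>i. (\<sigma> ^^ i) x)"

lemma orb_self: "x \<in> orb \<sigma> x"
  unfolding orb_def by (rule range_eqI[of _ _ 0]) simp

lemma orb_step: "u \<in> orb \<sigma> x \<Longrightarrow> \<sigma> u \<in> orb \<sigma> x"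
  unfolding orb_def by (auto intro: range_eqI[of _ _ "Suc _"])

lemma orb_subset:
  assumes "x \<in> B" "\<And>u. u \<in> B \<Longrightarrow> \<sigma> u \<in> B" shows "orb \<sigma> x \<subseteq> B"
proof -
  have "(\<sigma> ^^ i) x \<in> B" for i using assms by (induction i) auto
  then show ?thesis by (auto simp: orb_def)
qed

lemma orb_period:
  assumes "\<sigma> permutes V" "finite V"
  obtains p where "p > 0" "(\<sigma> ^^ p) x = x" "inj_on (\<lambda>i. (\<sigma> ^^ i) x) {..<p}"
    "orb \<sigma> x = (\<lambda>i. (\<sigma> ^^ i) x) ` {..<p}"
proof -
  have perm: "permutation \<sigma>" using assms permutation_permutes by blast
  let ?p = "least_power \<sigma> x"
  have "distinct (support \<sigma> x)" using cycle_of_permutation[OF perm] by simp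
  then have inj: "inj_on (\<lambda>i. (\<sigma> ^^ i) x) {..<?p}"
    by (simp only: distinct_map set_upt atLeast0LessThan)
  have orb: "orb \<sigma> x = (\<lambda>i. (\<sigma> ^^ i) x) ` {..<?p}"
    unfolding orb_def support_set[OF perm, symmetric] by (simp add: atLeast0LessThan)
  show ?thesis
    by (rule that[OF least_power_of_permutation(2,1)[OF perm] inj orb])
qed

text \<open>Only forward iterates are taken, but a cycle of finite length returns to
  \<open>x\<close>, so \<open>x\<close> is reached from \<open>u\<close> as well.\<close>

lemma orb_eq:
  assumes "\<sigma> permutes V" "finite V" "u \<in> orb \<sigma> x"
  shows "orb \<sigma> u = orb \<sigma> x"
proof -
  obtain p where p: "p > 0" "(\<sigma> ^^ p) x = x" "orb \<sigma> x = (\<lambda>i. (\<sigma> ^^ i) x) ` {..<p}"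
    using orb_period[OF assms(1,2)] by metis
  then obtain i where i: "i < p" "u = (\<sigma> ^^ i) x" using assms(3) by auto
  have "(\<sigma> ^^ (p - i)) u = x"
    using i p by (metis funpow_add comp_apply le_add_diff_inverse2 less_imp_le)
  then have "x \<in> orb \<sigma> u" unfolding orb_def by (metis rangeI)
  then show ?thesis
    using assms(3) by (intro equalityI orb_subset orb_step)
qed

text \<open>Every other edge of an even cycle gives a matching; an odd cycle without
  \<open>x\<close> is a path of even order.\<close>

lemma orb_matching:
  assumes "\<sigma> permutes V" "finite V" and sym: "\<And>a b. E a b \<Longrightarrow> E b a"
    and E: "\<And>u. u \<in> orb \<sigma> x \<Longrightarrow> E u (\<sigma> u)"
  shows "even (card (orb \<sigma> x)) \<Longrightarrow> \<exists>\<tau>. matching_on E (orb \<sigma> x) \<tau>"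
    and "odd (card (orb \<sigma> x)) \<Longrightarrow> \<exists>\<tau>. matching_on E (orb \<sigma> x - {x}) \<tau>"
proof -
  obtain p where p: "p > 0" "(\<sigma> ^^ p) x = x" "inj_on (\<lambda>i. (\<sigma> ^^ i) x) {..<p}"
    "orb \<sigma> x = (\<lambda>i. (\<sigma> ^^ i) x) ` {..<p}"
    using orb_period[OF assms(1,2)] by metis
  have card: "card (orb \<sigma> x) = p" using p(3,4) by (simp add: card_image)
  have E': "E ((\<sigma> ^^ i) x) ((\<sigma> ^^ Suc i) x)" for i
    using E[of "(\<sigma> ^^ i) x"] by (simp add: orb_def)
  show "\<exists>\<tau>. matching_on E (orb \<sigma> x) \<tau>" if ev: "even (card (orb \<sigma> x))"
  proof -
    obtain m where m: "p = 2 * m" using ev unfolding card by (rule evenE)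
    have "\<exists>\<tau>. matching_on E ((\<lambda>i. (\<sigma> ^^ i) x) ` {..<2 * m}) \<tau>"
      using p(3) E' sym unfolding m by (intro matching_on_path) blast+
    then show ?thesis using p(4) m by simp
  qed
  show "\<exists>\<tau>. matching_on E (orb \<sigma> x - {x}) \<tau>" if od: "odd (card (orb \<sigma> x))"
  proof -
    obtain m where m: "p = Suc (2 * m)"
      using od unfolding card Suc_eq_plus1 by (rule oddE)
    have "orb \<sigma> x = insert x ((\<lambda>i. (\<sigma> ^^ Suc i) x) ` {..<2 * m})"
      unfolding p(4) m lessThan_Suc_eq_insert_0 image_insert image_image by simp
    moreover have "x \<notin> (\<lambda>i. (\<sigma> ^^ Suc i) x) ` {..<2 * m}"
    proof
      assume "x \<in> (\<lambda>i. (\<sigma> ^^ Suc i) x) ` {..<2 * m}"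
      then obtain i where "i < 2 * m" "(\<sigma> ^^ 0) x = (\<sigma> ^^ Suc i) x" by auto
      then show False using inj_onD[OF p(3), of 0 "Suc i"] m by simp
    qed
    moreover have inj: "inj_on (\<lambda>i. (\<sigma> ^^ Suc i) x) {..<2 * m}"
    proof (rule inj_onI)
      fix i j assume "i \<in> {..<2 * m}" "j \<in> {..<2 * m}" "(\<sigma> ^^ Suc i) x = (\<sigma> ^^ Suc j) x"
      then show "i = j" using inj_onD[OF p(3), of "Suc i" "Suc j"] m by simp
    qed
    moreover have "\<exists>\<tau>. matching_on E ((\<lambda>i. (\<sigma> ^^ Suc i) x) ` {..<2 * m}) \<tau>"
      using E' sym by (intro matching_on_path inj) blast+
    ultimately show ?thesis by simp
  qed
qed

text \<open>If \<open>Q\<close> changed at every step, an odd number of steps around the cycle would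
  negate \<open>Q x\<close>.\<close>

lemma odd_orb_not_alternating:
  fixes Q :: "'a \<Rightarrow> bool"
  assumes "\<sigma> permutes V" "finite V" "odd (card (orb \<sigma> x))"
  shows "\<exists>u \<in> orb \<sigma> x. Q (\<sigma> u) = Q u"
proof (rule ccontr)
  assume "\<not> ?thesis"
  then have alt: "Q (\<sigma> u) = (\<not> Q u)" if "u \<in> orb \<sigma> x" for u using that by blast
  obtain p where p: "(\<sigma> ^^ p) x = x" "inj_on (\<lambda>i. (\<sigma> ^^ i) x) {..<p}"
    "orb \<sigma> x = (\<lambda>i. (\<sigma> ^^ i) x) ` {..<p}"
    using orb_period[OF assms(1,2)] by metis
  then have "card (orb \<sigma> x) = p" by (simp add: card_image)
  have "Q ((\<sigma> ^^ i) x) = (Q x = even i)" for i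
  proof (induction i)
    case (Suc i)
    have "(\<sigma> ^^ i) x \<in> orb \<sigma> x" by (simp add: orb_def)
    then show ?case using Suc alt by simp
  qed simp
  from this[of p] show False using p(1) \<open>card (orb \<sigma> x) = p\<close> assms(3) by simp
qed

text \<open>An odd cycle is not bipartite, so the vertex values cannot separate every edge into a low
  and a high end.\<close>
lemma odd_orb_edges_separated:
  fixes d :: "'a \<Rightarrow> 'b :: linorder"
  assumes "\<sigma> permutes V" "finite V" "odd (card (orb \<sigma> x))"
  obtains u v where "u \<in> orb \<sigma> x" "v \<in> orb \<sigma> x" "max (d u) (d (\<sigma> u)) \<le> min (d v) (d (\<sigma> v))"
proof -
  let ?O = "orb \<sigma> x"
  let ?hi = "\<lambda>u. max (d u) (d (\<sigma> u))"
  \<comment> \<open>An infinite set has \<open>card\<close> 0, which is even.\<close>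
  have fin: "finite ?O" using assms(3) card.infinite by fastforce
  then have "Min (?hi ` ?O) \<in> ?hi ` ?O" using orb_self[of x \<sigma>] by (intro Min_in) auto
  then obtain u where u: "u \<in> ?O" "?hi u = Min (?hi ` ?O)" by auto
  \<comment> \<open>The threshold is the least upper end of an edge. By minimality every edge has an
    end at or above it; if both ends lie on the same side, then both do.\<close>
  obtain v where v: "v \<in> ?O" "(d (\<sigma> v) \<ge> ?hi u) = (d v \<ge> ?hi u)"
    using odd_orb_not_alternating[OF assms, of "\<lambda>w. d w \<ge> ?hi u"] by blast
  have "?hi u \<le> ?hi v" using u v(1) fin by simp
  then have "?hi u \<le> min (d v) (d (\<sigma> v))" using v(2) by (auto simp: le_max_iff_disj)
  then show ?thesis using that u(1) v(1) by blast
qed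

section \<open>Multi-switches\<close>

text \<open>The vertex \<open>u\<close> itself is left out since the value \<open>col u u\<close> is
  arbitrary.\<close>

definition cdeg :: "'a set \<Rightarrow> ('a \<Rightarrow> 'a \<Rightarrow> 'c) \<Rightarrow> 'c \<Rightarrow> 'a \<Rightarrow> nat" where
  "cdeg V col c u = card {v \<in> V. v \<noteq> u \<and> col u v = c}"

text \<open>Exchanges the colours of \<open>xz\<close> and \<open>yz\<close> for all \<open>z \<in> Z\<close>.\<close>
definition multi_switch :: "'a \<Rightarrow> 'a \<Rightarrow> 'a set \<Rightarrow> ('a \<Rightarrow> 'a \<Rightarrow> 'c) \<Rightarrow> 'a \<Rightarrow> 'a \<Rightarrow> 'c" where
  "multi_switch x y Z col u v =
    (if u \<in> Z then col u (transpose x y v) else if v \<in> Z then col (transpose x y u) v else col u v)"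

lemma multi_switch_commute:
  assumes "\<And>u v. col u v = col v u" "x \<notin> Z" "y \<notin> Z"
  shows "multi_switch x y Z col u v = multi_switch x y Z col v u"
  using assms by (auto simp: multi_switch_def transpose_def)

lemma multi_switch_other: "u \<noteq> x \<Longrightarrow> u \<noteq> y \<Longrightarrow> v \<noteq> x \<Longrightarrow> v \<noteq> y \<Longrightarrow> multi_switch x y Z col u v = col u v"
  by (simp add: multi_switch_def)

lemma multi_switch_swap_ends: "multi_switch y x Z col = multi_switch x y Z col"
  by (simp add: multi_switch_def transpose_commute fun_eq_iff)

text \<open>On \<open>Z\<close> the vertex \<open>x\<close> takes over the colours of
  \<open>y\<close>, which form the same multiset as its own.\<close>

lemma cdeg_multi_switch_end:
  assumes V: "finite V" and Z: "Z \<subseteq> V - {x, y}"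
    and balanced: "image_mset (col x) (mset_set Z) = image_mset (col y) (mset_set Z)"
  shows "cdeg V (multi_switch x y Z col) c x = cdeg V col c x"
proof -
  have finZ: "finite Z" using V Z finite_subset by blast
  let ?R = "{v \<in> V - Z. v \<noteq> x \<and> col x v = c}"
  have "{v \<in> V. v \<noteq> x \<and> multi_switch x y Z col x v = c} = ?R \<union> {v \<in> Z. col y v = c}"
    using Z by (auto simp: multi_switch_def)
  then have "cdeg V (multi_switch x y Z col) c x = card ?R + card {v \<in> Z. col y v = c}"
    unfolding cdeg_def using V finZ by (simp add: card_Un_disjoint disjoint_iff)
  also have "card {v \<in> Z. col y v = c} = card {v \<in> Z. col x v = c}"
    using arg_cong[OF balanced, of "\<lambda>A. count A c"] finZ
    by (simp add: count_image_mset_eq_card_vimage)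
  also have "card ?R + card {v \<in> Z. col x v = c} = card (?R \<union> {v \<in> Z. col x v = c})"
    using V finZ by (subst card_Un_disjoint) auto
  also have "?R \<union> {v \<in> Z. col x v = c} = {v \<in> V. v \<noteq> x \<and> col x v = c}"
    using Z by auto
  finally show ?thesis by (simp add: cdeg_def)
qed

text \<open>A vertex of \<open>Z\<close> merely interchanges its edges to \<open>x\<close> and
  \<open>y\<close>, the ends \<open>x\<close> and \<open>y\<close> are balanced, and all other
  vertices keep their colours.\<close>

lemma cdeg_multi_switch:
  assumes V: "finite V" "x \<in> V" "y \<in> V" and Z: "Z \<subseteq> V - {x, y}"
    and balanced: "image_mset (col x) (mset_set Z) = image_mset (col y) (mset_set Z)"
  shows "cdeg V (multi_switch x y Z col) c u = cdeg V col c u"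
proof -
  consider "u = x" | "u = y" | "u \<in> Z" | "u \<noteq> x" "u \<noteq> y" "u \<notin> Z" by blast
  then show ?thesis
  proof cases
    case 1
    then show ?thesis using cdeg_multi_switch_end assms by metis
  next
    case 2
    have "Z \<subseteq> V - {y, x}" using Z by blast
    from cdeg_multi_switch_end[OF V(1) this balanced[symmetric]] 2
    show ?thesis by (simp add: multi_switch_swap_ends)
  next
    case 3
    have ne: "u \<noteq> x" "u \<noteq> y" using 3 Z by auto
    have "bij_betw (transpose x y) {v \<in> V. v \<noteq> u \<and> multi_switch x y Z col u v = c}
        {v \<in> V. v \<noteq> u \<and> col u v = c}"
      by (rule bij_betw_byWitness[where f' = "transpose x y"])
        (use 3 V ne in \<open>auto simp: multi_switch_def transpose_def\<close>)
    then show ?thesis unfolding cdeg_def by (rule bij_betw_same_card)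
  next
    case 4
    then show ?thesis by (simp add: cdeg_def multi_switch_def)
  qed
qed

text \<open>Adjacency in a digraph on the colours whose arcs are the elements of \<open>W\<close>,
  with tails \<open>t\<close> and heads \<open>h\<close>. For vertices \<open>x\<close> and
  \<open>y\<close> these are \<open>col x\<close> and \<open>col y\<close>.\<close>

definition arc :: "'z set \<Rightarrow> ('z \<Rightarrow> 'c) \<Rightarrow> ('z \<Rightarrow> 'c) \<Rightarrow> 'c \<Rightarrow> 'c \<Rightarrow> bool" where
  "arc W t h a b \<longleftrightarrow> (\<exists>z\<in>W. t z = a \<and> h z = b)"

text \<open>One arc is chosen for each step of the path. An inner vertex is once a head and once a
  tail, so tails and heads differ only in \<open>p\<close> and \<open>q\<close>. The conjuncts on
  \<open>set (p # cs)\<close> keep \<open>t\<close> injective through the induction.\<close>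

lemma arcs_of_simple_path:
  assumes "rtrancl_path (arc W t h) p cs q" "distinct (p # cs)"
  shows "\<exists>Z. Z \<subseteq> W \<and> finite Z \<and> inj_on t Z \<and> t ` Z \<subseteq> set (p # cs) \<and> q \<in> set (p # cs) \<and> q \<notin> t ` Z \<and>
    image_mset t (mset_set Z) + {#q#} = image_mset h (mset_set Z) + {#p#}"
  using assms
proof (induction rule: rtrancl_path.induct)
  case (base p)
  show ?case by (intro exI[of _ "{}"]) simp
next
  case (step p y cs q)
  then obtain Z where Z: "Z \<subseteq> W" "finite Z" "inj_on t Z" "t ` Z \<subseteq> set (y # cs)"
      "q \<in> set (y # cs)" "q \<notin> t ` Z"
      "image_mset t (mset_set Z) + {#q#} = image_mset h (mset_set Z) + {#y#}"
    by auto
  obtain w where w: "w \<in> W" "t w = p" "h w = y" using step.hyps by (auto simp: arc_def)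
  have p: "p \<notin> t ` Z" "p \<noteq> q" using Z step.prems by auto
  then have "w \<notin> Z" using w by blast
  then show ?case
    using Z w p by (intro exI[of _ "insert w Z"]) (auto simp: inj_on_insert)
qed

text \<open>The arc \<open>a\<close> closes a simple path from \<open>h a\<close> to
  \<open>f\<close>. Injectivity of \<open>t\<close> records that every colour is left at most once,
  and \<open>f\<close> only through \<open>a\<close>.\<close>

lemma simple_circuit_through:
  assumes a: "a \<in> W" "t a = f" and reach: "(arc W t h)\<^sup>*\<^sup>* (h a) f"
  obtains Z where "Z \<subseteq> W" "a \<in> Z" "inj_on t Z"
    "image_mset t (mset_set Z) = image_mset h (mset_set Z)"
proof -
  obtain cs where "rtrancl_path (arc W t h) (h a) cs f"
    using reach by (auto simp: rtranclp_eq_rtrancl_path)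
  then obtain cs where "rtrancl_path (arc W t h) (h a) cs f" "distinct (h a # cs)"
    using rtrancl_path_distinct by metis
  then obtain Z where Z: "Z \<subseteq> W" "finite Z" "inj_on t Z" "f \<notin> t ` Z"
      "image_mset t (mset_set Z) + {#f#} = image_mset h (mset_set Z) + {#h a#}"
    using arcs_of_simple_path by metis
  have "a \<notin> Z" using Z(4) a(2) by blast
  then show ?thesis
    using that[of "insert a Z"] Z a by (auto simp: inj_on_insert)
qed

text \<open>\<open>F\<close> is the colour of the regular factor, \<open>M\<close> are the colours of the perfect matchings found so
  far, \<open>H\<close> is the rest of the graph and \<open>N\<close> its complement.\<close>
locale colour_classes =
  fixes V :: "'a set" and D :: "'c \<Rightarrow> 'a \<Rightarrow> nat" and H N F :: 'c and M :: "'c set"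
    and r s :: nat
  assumes finite_V: "finite V" and even_V: "even (card V)"
    and finite_M: "finite M" and card_M: "card M \<le> 3"
    and distinct_colours: "H \<noteq> N" "F \<noteq> H" "F \<noteq> N" "F \<notin> M" "H \<notin> M" "N \<notin> M"
    and D_F: "\<And>u. u \<in> V \<Longrightarrow> D F u = r" and r_pos: "r > 0"
    and D_M: "\<And>c u. c \<in> M \<Longrightarrow> u \<in> V \<Longrightarrow> D c u = 1"
    and D_HN: "\<And>u. u \<in> V \<Longrightarrow> D H u + D N u = s"
begin

definition colouring :: "('a \<Rightarrow> 'a \<Rightarrow> 'c) \<Rightarrow> bool" where
  "colouring col \<longleftrightarrow> (\<forall>u v. col u v = col v u) \<and>
    (\<forall>u\<in>V. \<forall>v\<in>V. u \<noteq> v \<longrightarrow> col u v \<in> {H, N, F} \<union> M) \<and>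
    (\<forall>u\<in>V. \<forall>c. cdeg V col c u = D c u)"

definition reaches :: "('a \<Rightarrow> 'a \<Rightarrow> 'c) \<Rightarrow> 'a \<Rightarrow> 'a \<Rightarrow> 'c \<Rightarrow> bool" where
  "reaches col x y c \<longleftrightarrow> (arc (V - {x, y}) (col x) (col y))\<^sup>*\<^sup>* c F"

lemma colouring_multi_switch:
  assumes col: "colouring col" and xy: "x \<in> V" "y \<in> V" and Z: "Z \<subseteq> V - {x, y}"
    and balanced: "image_mset (col x) (mset_set Z) = image_mset (col y) (mset_set Z)"
  shows "colouring (multi_switch x y Z col)"
proof -
  have "multi_switch x y Z col u v = multi_switch x y Z col v u" for u v
    using col Z by (intro multi_switch_commute) (auto simp: colouring_def)
  moreover have "multi_switch x y Z col u v \<in> {H, N, F} \<union> M" if "u \<in> V" "v \<in> V" "u \<noteq> v" for u v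
  proof -
    define C where "C = {H, N, F} \<union> M"
    have "col a b \<in> C" if "a \<in> V" "b \<in> V" "a \<noteq> b" for a b
      using col that unfolding colouring_def C_def by blast
    then have "multi_switch x y Z col u v \<in> C"
      unfolding multi_switch_def transpose_def using that xy Z by auto
    then show ?thesis unfolding C_def .
  qed
  moreover have "cdeg V (multi_switch x y Z col) c u = D c u" if "u \<in> V" for c u
    using cdeg_multi_switch[OF finite_V xy Z balanced] col that unfolding colouring_def by simp
  ultimately show ?thesis unfolding colouring_def by blast
qed

text \<open>Let \<open>S\<close> be the set of colours reachable from \<open>col y a\<close>. It is
  closed under arcs, so every \<open>z\<close> joined to \<open>x\<close> in a colour of
  \<open>S\<close> is joined to \<open>y\<close> in one; the vertex \<open>a\<close> counts at
  \<open>y\<close> only, because \<open>F \<notin> S\<close>. So \<open>y\<close> has the larger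
  degree in \<open>S\<close>. Degrees in \<open>F\<close> and \<open>M\<close> are constant, hence
  the surplus comes from \<open>H\<close> or \<open>N\<close>.\<close>

lemma not_reaches_degree:
  assumes col: "colouring col" and xy: "x \<in> V" "y \<in> V" "x \<noteq> y"
    and a: "a \<in> V" "a \<noteq> x" "a \<noteq> y" "col x a = F" and nr: "\<not> reaches col x y (col y a)"
  shows "col y a = H \<Longrightarrow> D H x < D H y" "col y a = N \<Longrightarrow> D H y < D H x"
proof -
  let ?W = "V - {x, y}"
  let ?R = "(arc ?W (col x) (col y))\<^sup>*\<^sup>*"
  define S where "S = {c \<in> {H, N, F} \<union> M. ?R (col y a) c}"
  have finS: "finite S" using finite_M by (simp add: S_def)
  have colours: "col u v \<in> {H, N, F} \<union> M" if "u \<in> V" "v \<in> V" "u \<noteq> v" for u v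
    using col that unfolding colouring_def by blast
  have sym: "col u v = col v u" for u v using col unfolding colouring_def by blast
  \<comment> \<open>The edge \<open>xy\<close> is counted apart; it contributes equally at both
    ends.\<close>
  have deg: "D c u = card {z \<in> ?W. col u z = c} + of_bool (col x y = c)"
    if "u = x \<or> u = y" for u c
  proof -
    have "D c u = card {v \<in> V. v \<noteq> u \<and> col u v = c}"
      using col xy that unfolding colouring_def cdeg_def by auto
    also have "{v \<in> V. v \<noteq> u \<and> col u v = c} =
        {z \<in> ?W. col u z = c} \<union> (if col x y = c then {x, y} - {u} else {})"
      using that xy sym by auto
    also have "card \<dots> = card {z \<in> ?W. col u z = c} +
        card (if col x y = c then {x, y} - {u} else {})"
      using finite_V by (intro card_Un_disjoint) auto
    also have "card (if col x y = c then {x, y} - {u} else {}) = of_bool (col x y = c)"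
      using that xy(3) by auto
    finally show ?thesis .
  qed
  have sum_deg: "(\<Sum>c\<in>S. D c u) = card {z \<in> ?W. col u z \<in> S} + (\<Sum>c\<in>S. of_bool (col x y = c))"
    if u: "u = x \<or> u = y" for u
  proof -
    have "(\<Sum>c\<in>S. card {z \<in> ?W. col u z = c}) = card (\<Union>c\<in>S. {z \<in> ?W. col u z = c})"
      using finite_V finS by (subst card_UN_disjoint) auto
    also have "(\<Union>c\<in>S. {z \<in> ?W. col u z = c}) = {z \<in> ?W. col u z \<in> S}" by auto
    finally show ?thesis using deg[OF u] by (simp add: sum.distrib)
  qed
  have "{z \<in> ?W. col x z \<in> S} \<subset> {z \<in> ?W. col y z \<in> S}"
  proof
    show "{z \<in> ?W. col x z \<in> S} \<subseteq> {z \<in> ?W. col y z \<in> S}"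
    proof safe
      fix z assume z: "z \<in> V" "z \<noteq> x" "z \<noteq> y" "col x z \<in> S"
      then have "arc ?W (col x) (col y) (col x z) (col y z)" by (auto simp: arc_def)
      moreover have "?R (col y a) (col x z)" using z(4) unfolding S_def by blast
      ultimately have "?R (col y a) (col y z)" by (rule rtranclp.rtrancl_into_rtrancl[rotated])
      then show "col y z \<in> S" using colours z xy unfolding S_def by auto
    qed
    have "a \<in> {z \<in> ?W. col y z \<in> S}" using a xy colours[of y a] by (auto simp: S_def)
    moreover have "a \<notin> {z \<in> ?W. col x z \<in> S}"
      using a nr by (auto simp: S_def reaches_def)
    ultimately show "{z \<in> ?W. col x z \<in> S} \<noteq> {z \<in> ?W. col y z \<in> S}" by blast
  qed
  then have "card {z \<in> ?W. col x z \<in> S} < card {z \<in> ?W. col y z \<in> S}"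
    using finite_V by (intro psubset_card_mono) auto
  then have less: "(\<Sum>c\<in>S. D c x) < (\<Sum>c\<in>S. D c y)" using sum_deg by simp
  have split: "(\<Sum>c\<in>S. D c u) = (\<Sum>c\<in>S - {H, N}. D c u) + (\<Sum>c\<in>S \<inter> {H, N}. D c u)" for u
    using finS by (subst sum.union_disjoint[symmetric]) (auto intro: sum.cong)
  have "(\<Sum>c\<in>S - {H, N}. D c x) = (\<Sum>c\<in>S - {H, N}. D c y)"
    using xy by (intro sum.cong) (auto simp: S_def D_F D_M)
  then have less: "(\<Sum>c\<in>S \<inter> {H, N}. D c x) < (\<Sum>c\<in>S \<inter> {H, N}. D c y)"
    using less split by simp
  have HN: "D H x + D N x = D H y + D N y" using D_HN xy by simp
  have S_HN: "S \<inter> {H, N} = (if H \<in> S then {H} else {}) \<union> (if N \<in> S then {N} else {})" by auto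
  \<comment> \<open>With both or neither of \<open>H\<close> and \<open>N\<close> in
    \<open>S\<close> the sums would agree by \<open>HN\<close>. If only \<open>N\<close> is in
    \<open>S\<close>, the larger \<open>N\<close>-degree of \<open>y\<close> means a smaller
    \<open>H\<close>-degree.\<close>
  have imp: "(H \<in> S \<and> N \<notin> S \<and> D H x < D H y) \<or> (N \<in> S \<and> H \<notin> S \<and> D H y < D H x)"
    using less HN distinct_colours(1) unfolding S_HN by (auto split: if_splits)
  show "D H x < D H y" if "col y a = H"
    using imp that by (auto simp: S_def)
  show "D H y < D H x" if "col y a = N"
    using imp that by (auto simp: S_def)
qed

section \<open>Splitting off a perfect matching\<close>

text \<open>A spanning family of disjoint edges and cycles of colour \<open>F\<close>: the cycles of
  length two stand for the edges.\<close>

definition F_permutation :: "('a \<Rightarrow> 'a \<Rightarrow> 'c) \<Rightarrow> ('a \<Rightarrow> 'a) \<Rightarrow> bool" where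
  "F_permutation col \<sigma> \<longleftrightarrow>
    colouring col \<and> \<sigma> permutes V \<and> (\<forall>u\<in>V. \<sigma> u \<noteq> u \<and> col u (\<sigma> u) = F)"

text \<open>For an \<open>F_permutation\<close> these are the vertices already matched; their number
  measures progress.\<close>

definition two_cycles :: "('a \<Rightarrow> 'a) \<Rightarrow> 'a set" where
  "two_cycles \<sigma> = {u \<in> V. \<sigma> (\<sigma> u) = u}"

lemma colouring_sym: "colouring col \<Longrightarrow> col u v = col v u"
  by (simp add: colouring_def)

text \<open>On a union \<open>B\<close> of longer cycles \<open>\<sigma>\<close> is replaced by
  \<open>\<tau>\<close>. All of \<open>B\<close> then lies on two-cycles, and the old two-cycles
  survive.\<close>

lemma rematch:
  assumes \<sigma>: "F_permutation col \<sigma>" and col': "colouring col'"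
    and B: "B \<subseteq> V" "B \<noteq> {}" "\<And>u. u \<in> B \<Longrightarrow> \<sigma> u \<in> B" "\<And>u. u \<in> B \<Longrightarrow> \<sigma> (\<sigma> u) \<noteq> u"
    and \<tau>: "matching_on (\<lambda>u v. col' u v = F) B \<tau>"
    and rest: "\<And>u. u \<in> V - B \<Longrightarrow> col' u (\<sigma> u) = F"
  shows "\<exists>\<sigma>'. F_permutation col' \<sigma>' \<and> card (two_cycles \<sigma>) < card (two_cycles \<sigma>')"
proof -
  have perm: "\<sigma> permutes V" and \<sigma>V: "\<And>u. u \<in> V \<Longrightarrow> \<sigma> u \<noteq> u"
    using \<sigma> by (auto simp: F_permutation_def)
  have inj: "inj \<sigma>" using perm by (rule permutes_inj)
  have \<tau>B: "\<tau> u \<in> B" "\<tau> u \<noteq> u" "\<tau> (\<tau> u) = u" "col' u (\<tau> u) = F" if "u \<in> B" for u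
    using \<tau> that unfolding matching_on_def by auto
  have "finite B" using B(1) finite_V finite_subset by blast
  then have "\<sigma> ` B = B"
    using B(3) inj by (intro endo_inj_surj) (auto intro: inj_on_subset)
  then have out: "\<sigma> u \<notin> B" if "u \<notin> B" for u
    using that inj by (metis imageE injD)
  define \<sigma>' where "\<sigma>' u = (if u \<in> B then \<tau> u else \<sigma> u)" for u
  have maps: "\<sigma>' u \<in> V" if "u \<in> V" for u
    using that \<tau>B(1) B(1) permutes_in_image[OF perm] by (auto simp: \<sigma>'_def)
  have "inj_on \<sigma>' V"
  proof (rule inj_onI)
    fix u v assume eq: "\<sigma>' u = \<sigma>' v"
    consider "u \<in> B" "v \<in> B" | "u \<notin> B" "v \<notin> B" | "u \<in> B \<longleftrightarrow> v \<notin> B" by blast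
    then show "u = v"
    proof cases
      case 1
      then show ?thesis using eq \<tau>B(3) by (metis \<sigma>'_def)
    next
      case 2
      then show ?thesis using eq inj by (simp add: \<sigma>'_def inj_eq)
    next
      case 3
      then show ?thesis using eq \<tau>B(1) out by (metis \<sigma>'_def)
    qed
  qed
  then have "bij_betw \<sigma>' V V"
    using maps endo_inj_surj[OF finite_V, of \<sigma>'] by (auto simp: bij_betw_def)
  then have "\<sigma>' permutes V"
    using B(1) perm by (intro bij_imp_permutes) (auto simp: \<sigma>'_def permutes_def)
  then have "F_permutation col' \<sigma>'"
    using col' \<tau>B \<sigma>V rest by (auto simp: F_permutation_def \<sigma>'_def)
  moreover have "two_cycles \<sigma> \<subset> two_cycles \<sigma>'"
  proof
    show "two_cycles \<sigma> \<subseteq> two_cycles \<sigma>'"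
    proof
      fix u assume u: "u \<in> two_cycles \<sigma>"
      then have "u \<notin> B" using B(4) by (auto simp: two_cycles_def)
      then show "u \<in> two_cycles \<sigma>'" using u out by (auto simp: two_cycles_def \<sigma>'_def)
    qed
    obtain b where b: "b \<in> B" using B(2) by blast
    then have "b \<in> two_cycles \<sigma>'" using \<tau>B B(1) by (auto simp: two_cycles_def \<sigma>'_def)
    moreover have "b \<notin> two_cycles \<sigma>" using b B(4) by (auto simp: two_cycles_def)
    ultimately show "two_cycles \<sigma> \<noteq> two_cycles \<sigma>'" by blast
  qed
  then have "card (two_cycles \<sigma>) < card (two_cycles \<sigma>')"
    using finite_V by (intro psubset_card_mono) (auto simp: two_cycles_def)
  ultimately show ?thesis by blast
qed

text \<open>\<open>\<sigma>\<close> commutes with its powers, and these are injective.\<close>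

lemma orb_no_two_cycle:
  assumes "\<sigma> permutes V" "\<sigma> (\<sigma> x) \<noteq> x" "u \<in> orb \<sigma> x"
  shows "\<sigma> (\<sigma> u) \<noteq> u"
proof -
  obtain i where i: "u = (\<sigma> ^^ i) x" using assms(3) by (auto simp: orb_def)
  have "\<sigma> (\<sigma> u) = (\<sigma> ^^ i) (\<sigma> (\<sigma> x))" unfolding i by (simp add: funpow_swap1)
  then show ?thesis
    using assms(2) inj_fn[OF permutes_inj[OF assms(1)], of i] i by (simp add: inj_eq)
qed

lemma orb_in_V: "\<sigma> permutes V \<Longrightarrow> x \<in> V \<Longrightarrow> orb \<sigma> x \<subseteq> V"
  by (rule orb_subset) (auto simp: permutes_in_image)

text \<open>Switching along a circuit through the arc \<open>x'\<close> gives the edge \<open>x'y\<close> the colour \<open>F\<close>. It joins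
  the odd cycles through \<open>x'\<close> and \<open>y\<close>, what remains of either is a path of even order, and these
  paths lose no edge, since the circuit visits \<open>F\<close> only once.\<close>
lemma merge_odd_cycles:
  assumes \<sigma>: "F_permutation col \<sigma>"
    and x': "x' \<in> V" "\<sigma> (\<sigma> x') \<noteq> x'" "odd (card (orb \<sigma> x'))"
    and y: "y \<in> V" "\<sigma> (\<sigma> y) \<noteq> y" "odd (card (orb \<sigma> y))" "y \<notin> orb \<sigma> x'"
    and x: "x \<in> orb \<sigma> x'" "x \<noteq> x'" "col x x' = F"
    and reach: "reaches col x y (col y x')"
  shows "\<exists>col' \<sigma>'. F_permutation col' \<sigma>' \<and> card (two_cycles \<sigma>) < card (two_cycles \<sigma>')"
proof -
  let ?P = "orb \<sigma> x'" and ?Q = "orb \<sigma> y" and ?E = "\<lambda>u v. col u v = F"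
  have col: "colouring col" and perm: "\<sigma> permutes V"
    and \<sigma>F: "\<And>u. u \<in> V \<Longrightarrow> col u (\<sigma> u) = F"
    using \<sigma> by (auto simp: F_permutation_def)
  note sym = colouring_sym[OF col]
  have PV: "?P \<subseteq> V" "?Q \<subseteq> V" using orb_in_V[OF perm] x'(1) y(1) by auto
  have disj: "?P \<inter> ?Q = {}"
    using y(4) orb_eq[OF perm finite_V] orb_self[of y \<sigma>] by blast
  have E: "?E u (\<sigma> u)" if "u \<in> ?P \<or> u \<in> ?Q" for u using \<sigma>F PV that by auto
  have symE: "?E b a" if "?E a b" for a b using that sym by metis
  obtain \<tau>P where \<tau>P: "matching_on ?E (?P - {x'}) \<tau>P"
    using orb_matching(2)[where E = ?E, OF perm finite_V symE _ x'(3)] E by blast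
  obtain \<tau>Q where \<tau>Q: "matching_on ?E (?Q - {y}) \<tau>Q"
    using orb_matching(2)[where E = ?E, OF perm finite_V symE _ y(3)] E by blast
  have xV: "x \<in> V" and xy: "x \<noteq> y" "x \<notin> ?Q" and x'y: "x' \<noteq> y" "x' \<in> ?P" "y \<in> ?Q" "x' \<notin> ?Q"
    using x(1) PV y(4) disj orb_self[of x' \<sigma>] orb_self[of y \<sigma>] by auto
  obtain Z where Z: "Z \<subseteq> V - {x, y}" "x' \<in> Z" "inj_on (col x) Z"
      "image_mset (col x) (mset_set Z) = image_mset (col y) (mset_set Z)"
    using simple_circuit_through[of x' "V - {x, y}" "col x" F "col y"] x'(1) x(2,3) x'y(1) reach
    unfolding reaches_def by blast
  define col' where "col' = multi_switch x y Z col"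
  have colouring': "colouring col'"
    unfolding col'_def using col xV y(1) Z(1,4) by (rule colouring_multi_switch)
  have other: "col' u v = col u v" if "u \<noteq> x" "u \<noteq> y" "v \<noteq> x" "v \<noteq> y" for u v
    using that by (simp add: col'_def multi_switch_other)
  \<comment> \<open>As \<open>col x\<close> is injective on \<open>Z\<close>, only \<open>x'\<close>
    among the switched vertices is joined to \<open>x\<close> in colour \<open>F\<close>.\<close>
  have at_x: "col' x v = F" "col' v x = F" if "v \<noteq> x'" "col x v = F" for v
  proof -
    have "v \<notin> Z" using that Z(2,3) x(3) by (auto dest: inj_onD)
    then show "col' x v = F" using Z(1) that by (auto simp: col'_def multi_switch_def)
    then show "col' v x = F" using colouring_sym[OF colouring'] by metis
  qed
  have new: "col' x' y = F" "col' y x' = F"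
  proof -
    show "col' x' y = F" using Z(2) x(3) sym by (simp add: col'_def multi_switch_def)
    then show "col' y x' = F" using colouring_sym[OF colouring'] by metis
  qed
  have P: "\<tau>P u \<in> ?P" "\<tau>P u \<noteq> x'" "\<tau>P u \<noteq> u" "\<tau>P (\<tau>P u) = u" "col u (\<tau>P u) = F"
    if "u \<in> ?P" "u \<noteq> x'" for u
    using \<tau>P that unfolding matching_on_def by auto
  have Q: "\<tau>Q u \<in> ?Q" "\<tau>Q u \<noteq> y" "\<tau>Q u \<noteq> u" "\<tau>Q (\<tau>Q u) = u" "col u (\<tau>Q u) = F"
    if "u \<in> ?Q" "u \<noteq> y" for u
    using \<tau>Q that unfolding matching_on_def by auto
  \<comment> \<open>Since \<open>y\<close> lies outside \<open>?P\<close>, only the matching edge at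
    \<open>x\<close> could be switched.\<close>
  have P': "col' u (\<tau>P u) = F" if u: "u \<in> ?P" "u \<noteq> x'" for u
  proof -
    consider "u = x" | "\<tau>P u = x" "u \<noteq> x" | "u \<noteq> x" "\<tau>P u \<noteq> x" by blast
    then show ?thesis
    proof cases
      case 1
      then show ?thesis using at_x P[OF u] by simp
    next
      case 2
      then show ?thesis using at_x(2)[of u] P(5)[OF u] sym[of x u] u by simp
    next
      case 3
      then show ?thesis using other P[OF u] u disj x'y(3) by (metis disjoint_iff)
    qed
  qed
  have Q': "col' u (\<tau>Q u) = F" if u: "u \<in> ?Q" "u \<noteq> y" for u
    using other[of u "\<tau>Q u"] Q[OF u] u xy by metis
  define \<tau> where
    "\<tau> u = (if u = x' then y else if u = y then x' else if u \<in> ?P then \<tau>P u else \<tau>Q u)" for u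
  have "matching_on (\<lambda>u v. col' u v = F) (?P \<union> ?Q) \<tau>"
    unfolding matching_on_def
  proof
    fix u assume "u \<in> ?P \<union> ?Q"
    then consider "u = x'" | "u = y" | "u \<in> ?P" "u \<noteq> x'" "u \<noteq> y" | "u \<in> ?Q" "u \<noteq> y" "u \<noteq> x'" "u \<notin> ?P"
      using disj by blast
    then show "\<tau> u \<in> ?P \<union> ?Q \<and> \<tau> u \<noteq> u \<and> \<tau> (\<tau> u) = u \<and> col' u (\<tau> u) = F"
    proof cases
      case 1
      then show ?thesis using x'y new by (simp add: \<tau>_def)
    next
      case 2
      then show ?thesis using x'y new by (simp add: \<tau>_def)
    next
      case 3
      then have "\<tau> u = \<tau>P u" "\<tau>P u \<noteq> y" using P(1) y(4) by (auto simp: \<tau>_def)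
      then show ?thesis using P[of u] P'[of u] 3 by (simp add: \<tau>_def)
    next
      case 4
      then have "\<tau> u = \<tau>Q u" "\<tau>Q u \<noteq> x'" "\<tau>Q u \<notin> ?P" using Q(1) x'y disj by (auto simp: \<tau>_def)
      then show ?thesis using Q[of u] Q'[of u] 4 by (simp add: \<tau>_def)
    qed
  qed
  \<comment> \<open>A cycle other than the two merged ones meets neither \<open>x\<close> nor
    \<open>y\<close>, so its edges keep their colour.\<close>
  moreover have "col' u (\<sigma> u) = F" if "u \<in> V - (?P \<union> ?Q)" for u
  proof -
    have "\<sigma> u \<notin> ?P \<union> ?Q"
    proof
      assume "\<sigma> u \<in> ?P \<union> ?Q"
      then have "orb \<sigma> (\<sigma> u) = ?P \<or> orb \<sigma> (\<sigma> u) = ?Q" using orb_eq[OF perm finite_V] by blast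
      moreover have "orb \<sigma> (\<sigma> u) = orb \<sigma> u"
        by (rule orb_eq[OF perm finite_V orb_step[OF orb_self]])
      ultimately show False using orb_self[of u \<sigma>] that by blast
    qed
    then show ?thesis using other[of u "\<sigma> u"] \<sigma>F that x(1) x'y by auto
  qed
  moreover have "\<sigma> u \<in> ?P \<union> ?Q \<and> \<sigma> (\<sigma> u) \<noteq> u" if "u \<in> ?P \<union> ?Q" for u
    using that orb_step[of u \<sigma>] orb_no_two_cycle[OF perm x'(2), of u]
      orb_no_two_cycle[OF perm y(2), of u] by blast
  ultimately have "\<exists>\<sigma>'. F_permutation col' \<sigma>' \<and> card (two_cycles \<sigma>) < card (two_cycles \<sigma>')"
    using PV x'y(2) by (intro rematch[OF \<sigma> colouring']) auto
  then show ?thesis by blast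
qed

lemma increase_two_cycles:
  assumes \<sigma>: "F_permutation col \<sigma>" and ne: "two_cycles \<sigma> \<noteq> V"
  shows "\<exists>col' \<sigma>'. F_permutation col' \<sigma>' \<and> card (two_cycles \<sigma>) < card (two_cycles \<sigma>')"
proof (rule ccontr)
  assume stuck: "\<not> ?thesis"
  have col: "colouring col" and perm: "\<sigma> permutes V"
    and \<sigma>F: "\<And>u. u \<in> V \<Longrightarrow> col u (\<sigma> u) = F" and \<sigma>ne: "\<And>u. u \<in> V \<Longrightarrow> \<sigma> u \<noteq> u"
    using \<sigma> by (auto simp: F_permutation_def)
  note sym = colouring_sym[OF col] and eq = orb_eq[OF perm finite_V]
  have \<sigma>V: "\<sigma> u \<in> V \<longleftrightarrow> u \<in> V" for u using permutes_in_image[OF perm] .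
  \<comment> \<open>An even cycle could be replaced by every other one of its edges, without any
    switch.\<close>
  have odd: "odd (card (orb \<sigma> x))" if x: "x \<in> V" "\<sigma> (\<sigma> x) \<noteq> x" for x
  proof
    assume ev: "even (card (orb \<sigma> x))"
    have OV: "orb \<sigma> x \<subseteq> V" using orb_in_V[OF perm x(1)] .
    have symF: "col b a = F" if "col a b = F" for a b using that sym by metis
    have "col u (\<sigma> u) = F" if "u \<in> orb \<sigma> x" for u using \<sigma>F OV that by blast
    then obtain \<tau> where \<tau>: "matching_on (\<lambda>u v. col u v = F) (orb \<sigma> x) \<tau>"
      using orb_matching(1)[where E = "\<lambda>u v. col u v = F", OF perm finite_V symF _ ev] by blast
    have "\<exists>\<sigma>'. F_permutation col \<sigma>' \<and> card (two_cycles \<sigma>) < card (two_cycles \<sigma>')"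
      by (rule rematch[OF \<sigma> col OV _ orb_step orb_no_two_cycle[OF perm x(2)] \<tau>])
        (use orb_self[of x \<sigma>] \<sigma>F in auto)
    then show False using stuck by blast
  qed
  define long where "long x \<longleftrightarrow> x \<in> V \<and> \<sigma> (\<sigma> x) \<noteq> x" for x
  \<comment> \<open>Cycle edges without direction, so that each can be used from both of its
    ends.\<close>
  define adj where "adj u v \<longleftrightarrow> v = \<sigma> u \<or> u = \<sigma> v" for u v
  have adj_sym: "adj u v \<Longrightarrow> adj v u" for u v by (auto simp: adj_def)
  have adjF: "u \<noteq> v \<and> col u v = F \<and> orb \<sigma> u = orb \<sigma> v" if "adj u v" "u \<in> V" "v \<in> V" for u v
    using that \<sigma>F \<sigma>ne sym eq[OF orb_step[OF orb_self]] unfolding adj_def by metis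
  have nr: "\<not> reaches col x y (col y x')"
    if "long x" "long x'" "long y" "orb \<sigma> x \<noteq> orb \<sigma> y" "adj x x'" for x x' y
  proof
    assume r: "reaches col x y (col y x')"
    have V: "x \<in> V" "x' \<in> V" "y \<in> V" using that by (auto simp: long_def)
    note a = adjF[OF that(5) V(1,2)]
    have x: "x \<in> orb \<sigma> x'" "x \<noteq> x'" "col x x' = F" using a orb_self[of x \<sigma>] by auto
    have y: "y \<notin> orb \<sigma> x'" using a that(4) eq[of y x'] by auto
    have L: "\<sigma> (\<sigma> x') \<noteq> x'" "\<sigma> (\<sigma> y) \<noteq> y" using that by (auto simp: long_def)
    show False
      using merge_odd_cycles[OF \<sigma> V(2) L(1) odd[OF V(2) L(1)] V(3) L(2) odd[OF V(3) L(2)] y x r] stuck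
      by contradiction
  qed
  have cross: "col y x' = H \<Longrightarrow> D H x < D H y" "col y x' = N \<Longrightarrow> D H y < D H x"
      "col y x' \<noteq> F"
    if h: "long x" "long x'" "long y" "orb \<sigma> x \<noteq> orb \<sigma> y" "adj x x'" for x x' y
  proof -
    have V: "x \<in> V" "x' \<in> V" "y \<in> V" using h by (auto simp: long_def)
    note a = adjF[OF h(5) V(1,2)]
    have ne: "x \<noteq> y" "x' \<noteq> x" "x' \<noteq> y" "col x x' = F" using h(4) a by auto
    note d = not_reaches_degree[OF col V(1,3) ne(1) V(2) ne(2,3,4) nr[OF h]]
    show "col y x' = H \<Longrightarrow> D H x < D H y" "col y x' = N \<Longrightarrow> D H y < D H x"
      using d by blast+
    show "col y x' \<noteq> F" using nr[OF h] by (auto simp: reaches_def)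
  qed
  \<comment> \<open>Otherwise \<open>y'\<close> would be an arc from this common colour to the
    colour of \<open>yy'\<close>, which is \<open>F\<close>.\<close>
  have opposite: "col y x' \<noteq> col x y'"
    if h: "long x" "long x'" "long y" "long y'" "orb \<sigma> x \<noteq> orb \<sigma> y" "adj x x'" "adj y y'" for x x' y y'
  proof
    assume e: "col y x' = col x y'"
    have V: "x \<in> V" "x' \<in> V" "y \<in> V" "y' \<in> V" using h by (auto simp: long_def)
    note a = adjF[OF h(7) V(3,4)]
    have "y' \<in> V - {x, y}" using V a h(5) by auto
    then have "arc (V - {x, y}) (col x) (col y) (col y x') F"
      using a e unfolding arc_def by metis
    then show False using nr[OF h(1,2,3,5,6)] by (auto simp: reaches_def)
  qed
  have M_neq: "col u v \<noteq> col u w" if "col u v \<in> M" "u \<in> V" "v \<in> V" "w \<in> V" "u \<noteq> v" "u \<noteq> w" "v \<noteq> w"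
    for u v w
  proof
    assume e: "col u v = col u w"
    have "card {z \<in> V. z \<noteq> u \<and> col u z = col u v} = 1"
      using col D_M that unfolding colouring_def cdeg_def by auto
    moreover have "{v, w} \<subseteq> {z \<in> V. z \<noteq> u \<and> col u z = col u v}" using e that by auto
    then have "card {v, w} \<le> card {z \<in> V. z \<noteq> u \<and> col u z = col u v}"
      using finite_V by (intro card_mono) auto
    ultimately show False using that by simp
  qed
  have overlap: "\<not> max (D H y) (D H y') \<le> min (D H x) (D H x')"
    if h: "long x" "long x'" "long y" "long y'" "orb \<sigma> x \<noteq> orb \<sigma> y" "adj x x'" "adj y y'" for x x' y y'
  proof
    assume le: "max (D H y) (D H y') \<le> min (D H x) (D H x')"
    have V: "x \<in> V" "x' \<in> V" "y \<in> V" "y' \<in> V" using h by (auto simp: long_def)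
    note ax = adjF[OF h(6) V(1,2)] and ay = adjF[OF h(7) V(3,4)]
    have o: "orb \<sigma> a \<noteq> orb \<sigma> b" "orb \<sigma> b \<noteq> orb \<sigma> a" if "a \<in> {x, x'}" "b \<in> {y, y'}" for a b
      using that ax ay h(5) by auto
    \<comment> \<open>By \<open>cross\<close>, the colour \<open>H\<close> on \<open>ab\<close>
      would make \<open>a'\<close> lower than \<open>b\<close>, and \<open>N\<close> would make
      \<open>a\<close> lower than \<open>b'\<close>; both contradict \<open>le\<close>.\<close>
    have inM: "col b a \<in> M" if ab: "a \<in> {x, x'}" "b \<in> {y, y'}" for a b
    proof -
      obtain a' where a': "a' \<in> {x, x'}" "adj a' a" using ab h(6) adj_sym by auto
      obtain b' where b': "b' \<in> {y, y'}" "adj b' b" using ab h(7) adj_sym by auto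
      have long: "long a" "long a'" "long b" "long b'" using ab a' b' h by auto
      have dle: "D H b \<le> D H a'" "D H b' \<le> D H a" using ab a' b' le by auto
      have "b \<noteq> a" using o ab by auto
      have "col b a \<noteq> F" "col b a \<noteq> H"
        using cross(1,3)[OF long(2,1,3) _ a'(2)] o a' ab dle by fastforce+
      moreover have "col b a \<noteq> N"
        using cross(2)[OF long(4,3,1) _ b'(2)] o b' ab dle sym[of a b] by fastforce
      moreover have "col b a \<in> {H, N, F} \<union> M"
        using col long \<open>b \<noteq> a\<close> unfolding colouring_def long_def by blast
      ultimately show ?thesis by blast
    qed
    have m: "col y x \<in> M" "col y' x \<in> M" "col y x' \<in> M" "col y' x' \<in> M" using inM by simp_all
    then have m': "col x y \<in> M" "col x' y \<in> M" using sym by metis+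
    have ne: "x \<noteq> x'" "y \<noteq> y'" "x \<noteq> y" "x \<noteq> y'" "x' \<noteq> y" "x' \<noteq> y'" using ax ay h(5) by auto
    \<comment> \<open>Edges with a common end differ because a matching colour occurs once at each
      vertex; the two disjoint pairs differ by \<open>opposite\<close>.\<close>
    have "col y x' \<noteq> col x y'" by (rule opposite[OF h])
    moreover have "col y x \<noteq> col x' y'"
      by (rule opposite[OF h(2,1,3,4) _ adj_sym[OF h(6)] h(7)]) (rule o, simp_all)
    moreover have "col y x \<noteq> col y x'" "col y' x \<noteq> col y' x'"
      by (rule M_neq; use m V ne in blast)+
    moreover have "col x y \<noteq> col x y'" "col x' y \<noteq> col x' y'"
      by (rule M_neq; use m' V ne in blast)+
    ultimately have "card {col y x, col y x', col y' x, col y' x'} = 4"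
      using sym[of x y] sym[of x y'] sym[of x' y] sym[of x' y'] by auto
    moreover have "{col y x, col y x', col y' x, col y' x'} \<subseteq> M" using m by blast
    then have "card {col y x, col y x', col y' x, col y' x'} \<le> card M" by (rule card_mono[OF finite_M])
    ultimately show False using card_M by simp
  qed
  obtain p where p: "long p" using ne by (auto simp: two_cycles_def long_def)
  let ?P = "orb \<sigma> p"
  have longP: "long u" if "u \<in> orb \<sigma> q" "long q" for u q
    using that orb_no_two_cycle[OF perm] orb_in_V[OF perm] unfolding long_def by blast
  \<comment> \<open>Otherwise the even set \<open>V\<close> would be the disjoint union of the even
    set \<open>two_cycles \<sigma>\<close> and the odd cycle \<open>?P\<close>.\<close>
  have "\<exists>q. long q \<and> q \<notin> ?P"
  proof (rule ccontr)
    assume no: "\<not> ?thesis"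
    have "V = two_cycles \<sigma> \<union> ?P" "two_cycles \<sigma> \<inter> ?P = {}"
      using no longP[OF _ p] by (auto simp: two_cycles_def long_def)
    moreover have "finite (two_cycles \<sigma>)" "finite ?P"
      using finite_V finite_subset[OF orb_in_V[OF perm]] p by (auto simp: two_cycles_def long_def)
    ultimately have "card V = card (two_cycles \<sigma>) + card ?P" by (metis card_Un_disjoint)
    moreover have "matching_on (\<lambda>_ _. True) (two_cycles \<sigma>) \<sigma>"
      unfolding matching_on_def two_cycles_def using \<sigma>V \<sigma>ne by auto
    then have "even (card (two_cycles \<sigma>))"
      by (rule even_card_matching_on[rotated]) (simp add: two_cycles_def finite_V)
    moreover have "odd (card ?P)" using odd p unfolding long_def by blast
    ultimately show False using even_V by simp
  qed
  then obtain q where q: "long q" "q \<notin> ?P" by blast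
  let ?Q = "orb \<sigma> q"
  have ne: "?P \<noteq> ?Q" using q(2) orb_self by metis
  obtain u v where uv: "u \<in> ?P" "v \<in> ?P" "max (D H u) (D H (\<sigma> u)) \<le> min (D H v) (D H (\<sigma> v))"
    using odd_orb_edges_separated[OF perm finite_V odd, of p "D H"] p unfolding long_def by blast
  obtain u' v' where uv': "u' \<in> ?Q" "v' \<in> ?Q" "max (D H u') (D H (\<sigma> u')) \<le> min (D H v') (D H (\<sigma> v'))"
    using odd_orb_edges_separated[OF perm finite_V odd, of q "D H"] q unfolding long_def by blast
  have adj\<sigma>: "adj w (\<sigma> w)" for w by (simp add: adj_def)
  have not_le: "\<not> max (D H b) (D H (\<sigma> b)) \<le> min (D H a) (D H (\<sigma> a))"
    if "a \<in> orb \<sigma> a0" "b \<in> orb \<sigma> b0" "orb \<sigma> a0 \<noteq> orb \<sigma> b0" "long a0" "long b0" for a b a0 b0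
  proof (rule overlap)
    show "long a" by (rule longP[OF that(1,4)])
    show "long (\<sigma> a)" by (rule longP[OF orb_step[OF that(1)] that(4)])
    show "long b" by (rule longP[OF that(2,5)])
    show "long (\<sigma> b)" by (rule longP[OF orb_step[OF that(2)] that(5)])
    show "orb \<sigma> a \<noteq> orb \<sigma> b" using eq[OF that(1)] eq[OF that(2)] that(3) by simp
  qed (rule adj\<sigma>)+
  \<comment> \<open>Writing \<open>hi\<close> and \<open>lo\<close> for the ends of an edge,
    \<open>hi u > lo v' \<ge> hi u' > lo v \<ge> hi u\<close>, a contradiction.\<close>
  have "\<not> max (D H u) (D H (\<sigma> u)) \<le> min (D H v') (D H (\<sigma> v'))"
    using not_le[OF uv'(2) uv(1) ne[symmetric] q(1) p] .
  moreover have "\<not> max (D H u') (D H (\<sigma> u')) \<le> min (D H v) (D H (\<sigma> v))"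
    using not_le[OF uv(2) uv'(1) ne p q(1)] .
  ultimately show False using uv(3) uv'(3) by linarith
qed

text \<open>Hall's condition follows by double counting: the \<open>r * card X\<close> ordered
  \<open>F\<close>-pairs leaving \<open>X\<close>, reversed, start in the neighbourhood of
  \<open>X\<close>, where each vertex starts \<open>r\<close> of them. An injective choice of
  neighbours on the finite set \<open>V\<close> is a permutation.\<close>

lemma ex_F_permutation:
  assumes col: "colouring col"
  shows "\<exists>\<sigma>. F_permutation col \<sigma>"
proof -
  define Nb where "Nb u = {v \<in> V. v \<noteq> u \<and> col u v = F}" for u
  have cardNb: "card (Nb u) = r" if "u \<in> V" for u
  proof -
    have "cdeg V col F u = D F u" using col that unfolding colouring_def by blast
    then show ?thesis using D_F[OF that] by (simp add: cdeg_def Nb_def)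
  qed
  have finNb: "finite (Nb u)" for u using finite_V by (simp add: Nb_def)
  have sym: "u \<in> Nb v \<longleftrightarrow> v \<in> Nb u" if "u \<in> V" "v \<in> V" for u v
    using that colouring_sym[OF col, of u v] by (auto simp: Nb_def)
  have cardSigma: "card (Sigma X Nb) = r * card X" if "X \<subseteq> V" for X
    using finite_subset[OF that finite_V] finNb cardNb that by (simp add: subset_iff)
  have "\<exists>f. inj_on f V \<and> (\<forall>u\<in>V. f u \<in> Nb u)"
  proof (rule hall_marriage[OF finite_V finNb])
    fix X assume X: "X \<subseteq> V"
    let ?Y = "\<Union>u\<in>X. Nb u"
    have fin: "finite X" "finite ?Y" using finite_subset[OF X finite_V] finNb by auto
    have YV: "?Y \<subseteq> V" by (auto simp: Nb_def)
    have "r * card X = card (Sigma X Nb)" using cardSigma[OF X] ..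
    also have "\<dots> = card ((\<lambda>(a, b). (b, a)) ` Sigma X Nb)"
      by (rule card_image[symmetric]) (auto simp: inj_on_def)
    also have "\<dots> \<le> card (Sigma ?Y Nb)"
    proof (rule card_mono)
      show "finite (Sigma ?Y Nb)" using fin finNb by blast
      show "(\<lambda>(a, b). (b, a)) ` Sigma X Nb \<subseteq> Sigma ?Y Nb"
        using X YV sym by (fastforce simp: subset_iff)
    qed
    also have "\<dots> = r * card ?Y" by (rule cardSigma[OF YV])
    finally show "card X \<le> card ?Y" using r_pos by simp
  qed
  then obtain f where f: "inj_on f V" "\<forall>u\<in>V. f u \<in> Nb u" by blast
  define \<sigma> where "\<sigma> u = (if u \<in> V then f u else u)" for u
  have "inj_on \<sigma> V" "\<sigma> ` V \<subseteq> V" using f by (auto simp: \<sigma>_def inj_on_def Nb_def)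
  then have "bij_betw \<sigma> V V" using endo_inj_surj[OF finite_V] by (auto simp: bij_betw_def)
  then have "\<sigma> permutes V" by (rule bij_imp_permutes) (simp add: \<sigma>_def)
  then have "F_permutation col \<sigma>"
    using f col by (auto simp: F_permutation_def \<sigma>_def Nb_def)
  then show ?thesis by blast
qed

lemma ex_F_matching:
  assumes "colouring col"
  obtains col' \<sigma> where "colouring col'" "matching_on (\<lambda>u v. col' u v = F) V \<sigma>"
proof -
  have "\<exists>col' \<sigma>'. F_permutation col' \<sigma>' \<and> two_cycles \<sigma>' = V" if "F_permutation col \<sigma>" for col \<sigma>
    using that
  proof (induction "card V - card (two_cycles \<sigma>)" arbitrary: col \<sigma> rule: less_induct)
    case less
    show ?case
    proof (cases "two_cycles \<sigma> = V")
      case False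
      then obtain col' \<sigma>' where *: "F_permutation col' \<sigma>'" "card (two_cycles \<sigma>) < card (two_cycles \<sigma>')"
        using increase_two_cycles less.prems by blast
      have "card (two_cycles \<sigma>') \<le> card V"
        using finite_V by (intro card_mono) (auto simp: two_cycles_def)
      then show ?thesis using less.hyps * by (meson diff_less_mono2 less_le_trans)
    qed (use less.prems in blast)
  qed
  then obtain col' \<sigma> where *: "F_permutation col' \<sigma>" "two_cycles \<sigma> = V"
    using ex_F_permutation[OF assms] by blast
  have "\<sigma> (\<sigma> u) = u" if "u \<in> V" for u using that *(2) by (auto simp: two_cycles_def)
  then have "matching_on (\<lambda>u v. col' u v = F) V \<sigma>"
    using *(1) permutes_in_image unfolding matching_on_def F_permutation_def by metis
  then show ?thesis using that *(1) unfolding F_permutation_def by blast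
qed

end

section \<open>Kundu's theorem\<close>

definition nbrs :: "'a set set \<Rightarrow> 'a \<Rightarrow> 'a set" where
  "nbrs E v = {u. {v, u} \<in> E}"

lemma nbrs_mem_commute: "u \<in> nbrs E v \<longleftrightarrow> v \<in> nbrs E u"
  by (simp add: nbrs_def insert_commute)

lemma nbrs_subset: "simple_graph (V, E) \<Longrightarrow> nbrs E v \<subseteq> V - {v}"
  unfolding simple_graph_def nbrs_def by auto

lemma finite_nbrs: "simple_graph (V, E) \<Longrightarrow> finite (nbrs E v)"
  using nbrs_subset finite_subset by (metis finite_Diff fst_conv simple_graph_def)

lemma degree_eq_card_nbrs:
  assumes "simple_graph (V, E)"
  shows "degree (V, E) v = card (nbrs E v)"
proof -
  have "{e \<in> E. v \<in> e} = (\<lambda>u. {v, u}) ` nbrs E v"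
  proof (intro equalityI subsetI)
    fix e assume e: "e \<in> {e \<in> E. v \<in> e}"
    then have "card e = 2" using assms unfolding simple_graph_def by auto
    then obtain a b where "e = {a, b}" by (auto simp: card_2_iff)
    then show "e \<in> (\<lambda>u. {v, u}) ` nbrs E v" using e by (auto simp: nbrs_def insert_commute)
  qed (auto simp: nbrs_def)
  moreover have "inj_on (\<lambda>u. {v, u}) (nbrs E v)" by (auto simp: inj_on_def doubleton_eq_iff)
  ultimately show ?thesis by (simp add: degree_def card_image)
qed

text \<open>Replace \<open>yz\<close> and \<open>xw\<close> by \<open>xz\<close> and
  \<open>yw\<close>. The common part with \<open>K\<close> gains \<open>xz\<close>; if it loses
  \<open>xw\<close>, it gains \<open>yw\<close> in return.\<close>

lemma two_switch:
  assumes G: "simple_graph (V, E)" and K: "simple_graph (V, K)" and w: "w \<noteq> y" "x \<noteq> y"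
    and z: "{x, z} \<in> K" "{x, z} \<notin> E" "{y, z} \<in> E" "{y, z} \<notin> K"
    and xw: "{x, w} \<in> E" "{y, w} \<notin> E" "{x, w} \<in> K \<Longrightarrow> {y, w} \<in> K"
  shows "\<exists>E'. simple_graph (V, E') \<and> (\<forall>v. degree (V, E') v = degree (V, E) v) \<and>
    card (E \<inter> K) < card (E' \<inter> K)"
proof -
  define E' where "E' = (E - {{y, z}, {x, w}}) \<union> {{x, z}, {y, w}}"
  have in_V: "u \<in> V \<and> v \<in> V \<and> u \<noteq> v" if "{u, v} \<in> E \<union> K" for u v
    using that G K unfolding simple_graph_def by (fastforce simp: card_insert_if)
  have ne: "x \<noteq> z" "y \<noteq> z" "x \<noteq> w" "z \<noteq> w"
    using in_V[of x z] in_V[of y z] in_V[of x w] z xw by auto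
  have simple: "simple_graph (V, E')"
    using G in_V[of x z] in_V[of y z] in_V[of x w] z xw w
    unfolding simple_graph_def E'_def by (auto simp: card_insert_if)
  have exch: "card (insert b (A - {a})) = card A" if "a \<in> A" "b \<notin> A" "finite A" for a b :: 'a and A
    using that card_Suc_Diff1[OF that(3,1)] by (simp del: card_Diff_insert)
  note fin = finite_nbrs[OF G]
  have "card (nbrs E' v) = card (nbrs E v)" for v
  proof -
    consider "v = x" | "v = y" | "v = z" | "v = w" | "v \<notin> {x, y, z, w}" by blast
    then show ?thesis
    proof cases
      case 1
      have "nbrs E' x = insert z (nbrs E x - {w})"
        using w ne z xw by (auto simp: nbrs_def E'_def doubleton_eq_iff)
      then show ?thesis using exch[of w "nbrs E x" z] fin 1 z xw by (simp add: nbrs_def)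
    next
      case 2
      have "nbrs E' y = insert w (nbrs E y - {z})"
        using w ne z xw by (auto simp: nbrs_def E'_def doubleton_eq_iff)
      then show ?thesis using exch[of z "nbrs E y" w] fin 2 z xw by (simp add: nbrs_def)
    next
      case 3
      have "nbrs E' z = insert x (nbrs E z - {y})"
        using w ne z xw by (auto simp: nbrs_def E'_def doubleton_eq_iff)
      then show ?thesis
        using exch[of y "nbrs E z" x] fin[of z] 3 z by (auto simp: nbrs_def insert_commute)
    next
      case 4
      have "nbrs E' w = insert y (nbrs E w - {x})"
        using w ne z xw by (auto simp: nbrs_def E'_def doubleton_eq_iff)
      then show ?thesis
        using exch[of x "nbrs E w" y] fin[of w] 4 xw(1,2) by (auto simp: nbrs_def insert_commute)
    next
      case 5
      then have "nbrs E' v = nbrs E v" by (auto simp: nbrs_def E'_def doubleton_eq_iff)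
      then show ?thesis by simp
    qed
  qed
  then have "\<forall>v. degree (V, E') v = degree (V, E) v"
    using degree_eq_card_nbrs[OF simple] degree_eq_card_nbrs[OF G] by simp
  moreover have "card (E \<inter> K) < card (E' \<inter> K)"
  proof -
    have "finite V" using G by (simp add: simple_graph_def)
    moreover have "E \<subseteq> Pow V" "E' \<subseteq> Pow V" using G simple by (auto simp: simple_graph_def)
    ultimately have finE: "finite E" "finite E'" by (meson finite_Pow_iff finite_subset)+
    show ?thesis
    proof (cases "{x, w} \<in> K")
      case False
      then have "insert {x, z} (E \<inter> K) \<subseteq> E' \<inter> K" using z by (auto simp: E'_def)
      then have "card (insert {x, z} (E \<inter> K)) \<le> card (E' \<inter> K)" using finE by (intro card_mono) auto
      then show ?thesis using z finE by simp
    next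
      case True
      let ?A = "E \<inter> K - {{x, w}}"
      have "insert {x, z} (insert {y, w} ?A) \<subseteq> E' \<inter> K"
        using z xw True by (auto simp: E'_def)
      then have "card (insert {x, z} (insert {y, w} ?A)) \<le> card (E' \<inter> K)"
        using finE by (intro card_mono) auto
      moreover have "{x, z} \<noteq> {y, w}" using ne w by (auto simp: doubleton_eq_iff)
      then have "card (insert {x, z} (insert {y, w} ?A)) = Suc (Suc (card ?A))"
        using z xw finE by simp
      moreover have "Suc (card ?A) = card (E \<inter> K)"
        using True xw finE by (intro card_Suc_Diff1) auto
      ultimately show ?thesis by simp
    qed
  qed
  ultimately show ?thesis using simple by blast
qed

lemma card_Diff_eq_add:
  assumes "finite A" "finite B" "card A = card B + k"
  shows "card (A - B) = card (B - A) + (k :: nat)"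
proof -
  have "card A = card (A - B) + card (A \<inter> B)"
    using assms by (metis card_Diff_subset_Int card_mono finite_Int inf_le1 le_add_diff_inverse2)
  moreover have "card B = card (B - A) + card (A \<inter> B)"
    using assms by (metis Int_commute card_Diff_subset_Int card_mono finite_Int inf_le1 le_add_diff_inverse2)
  ultimately show ?thesis using assms by simp
qed

text \<open>Kundu's theorem. In a pair maximising the number of common edges, let \<open>z\<close> be incident with
  \<open>xz \<in> K - E\<close> and \<open>yz \<in> E - K\<close>. As no switch at \<open>x\<close>, \<open>y\<close> helps, \<open>y\<close> has more edges in
  \<open>E - K\<close> than \<open>x\<close>, but no more edges in \<open>K - E\<close>.\<close>
lemma kundu_factor:
  assumes "simple_graph (V, E)" "simple_graph (V, K)"
    and "\<forall>v\<in>V. degree (V, E) v = degree (V, K) v + k"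
  shows "\<exists>E' K'. simple_graph (V, E') \<and> simple_graph (V, K') \<and> K' \<subseteq> E' \<and>
    (\<forall>v. degree (V, E') v = degree (V, E) v) \<and> (\<forall>v. degree (V, K') v = degree (V, K) v)"
  using assms
proof (induction "card (Pow V) - card (E \<inter> K)" arbitrary: E K rule: less_induct)
  case less
  note G = less.prems(1) and K = less.prems(2)
  show ?case
  proof (cases "K \<subseteq> E")
    case True
    then show ?thesis using less.prems by blast
  next
    case False
    then obtain e where e: "e \<in> K" "e \<notin> E" by blast
    have "card e = 2" "e \<subseteq> V" using e(1) K by (auto simp: simple_graph_def)
    then obtain x z where xz: "e = {x, z}" "x \<in> V" "z \<in> V" by (auto simp: card_2_iff)
    have diff: "card (nbrs E v - nbrs K v) = card (nbrs K v - nbrs E v) + k" if "v \<in> V" for v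
      using less.prems(3) that finite_nbrs[OF G] finite_nbrs[OF K]
      by (intro card_Diff_eq_add) (simp_all add: degree_eq_card_nbrs[OF G] degree_eq_card_nbrs[OF K])
    have fin: "finite (nbrs E v)" "finite (nbrs K v)" for v
      using finite_nbrs[OF G] finite_nbrs[OF K] by auto
    have "x \<in> nbrs K z - nbrs E z" using e xz by (simp add: nbrs_def insert_commute)
    then have "card (nbrs K z - nbrs E z) > 0" using fin by (auto simp: card_gt_0_iff)
    \<comment> \<open>The \<open>K - E\<close> edge at \<open>z\<close> forces an
      \<open>E - K\<close> edge there, as \<open>diff\<close> gives at least as many of the
      latter.\<close>
    then have "card (nbrs E z - nbrs K z) > 0" using diff[OF xz(3)] by linarith
    then have "nbrs E z - nbrs K z \<noteq> {}" using card_gt_0_iff by blast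
    then obtain y where y: "{y, z} \<in> E" "{y, z} \<notin> K" by (auto simp: nbrs_def insert_commute)
    have yV: "y \<in> V" using y(1) G by (auto simp: simple_graph_def)
    have xy: "x \<noteq> y" using e xz y by auto
    have bound: "card (A \<inter> B) \<le> card (Pow V)" if "simple_graph (V, A)" for A B
      using that by (intro card_mono) (auto simp: simple_graph_def)
    show ?thesis
    proof (cases "\<exists>w. w \<noteq> y \<and> {x, w} \<in> E \<and> {y, w} \<notin> E \<and> ({x, w} \<in> K \<longrightarrow> {y, w} \<in> K)")
      case True
      then obtain E' where E': "simple_graph (V, E')" "\<forall>v. degree (V, E') v = degree (V, E) v"
          "card (E \<inter> K) < card (E' \<inter> K)"
        using two_switch[OF G K, of _ y x z] xy e xz y by metis
      have "card (Pow V) - card (E' \<inter> K) < card (Pow V) - card (E \<inter> K)"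
        using E'(3) bound[OF E'(1), of K] by linarith
      from less.hyps[OF this E'(1) K] E'(2) less.prems(3) show ?thesis by simp
    next
      case noE: False
      show ?thesis
      proof (cases "\<exists>w. w \<noteq> x \<and> {y, w} \<in> K \<and> {x, w} \<notin> K \<and> ({y, w} \<in> E \<longrightarrow> {x, w} \<in> E)")
        case True
        then obtain K' where K': "simple_graph (V, K')" "\<forall>v. degree (V, K') v = degree (V, K) v"
            "card (K \<inter> E) < card (K' \<inter> E)"
          using two_switch[OF K G, of _ x y z] xy e xz y by metis
        have "card (Pow V) - card (E \<inter> K') < card (Pow V) - card (E \<inter> K)"
          using K'(3) bound[OF K'(1), of E] by (simp add: Int_commute)
        from less.hyps[OF this G K'(1)] K'(2) less.prems(3) show ?thesis by simp
      next
        case noK: False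
        \<comment> \<open>Adjacency is symmetric, so leaving out \<open>y\<close> at
          \<open>x\<close> and \<open>x\<close> at \<open>y\<close> lowers both counts by the same
          amount.\<close>
        have card_remove: "card (A - {a}) < card (B - {b}) \<Longrightarrow> (a \<in> A \<longleftrightarrow> b \<in> B) \<Longrightarrow> card A < card B"
          "card (A - {a}) \<le> card (B - {b}) \<Longrightarrow> (a \<in> A \<longleftrightarrow> b \<in> B) \<Longrightarrow> card A \<le> card B"
          if "finite A" "finite B" for a b :: 'a and A B
          using that card_gt_0_iff[of A] card_gt_0_iff[of B]
          by (auto simp: card_Diff_singleton_if split: if_splits)
        let ?g = "\<lambda>v. nbrs E v - nbrs K v" and ?h = "\<lambda>v. nbrs K v - nbrs E v"
        \<comment> \<open>For \<open>xw\<close> in \<open>E - K\<close>, \<open>noE\<close> forces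
          \<open>yw \<in> E\<close> and then \<open>noK\<close> forces \<open>yw \<notin> K\<close>.
          The vertex \<open>z\<close> makes the inclusion strict.\<close>
        have "?g x - {y} \<subseteq> ?g y - {x}"
          using noE noK G by (auto simp: nbrs_def simple_graph_def)
        moreover have "z \<in> ?g y - {x}" "z \<notin> ?g x - {y}"
          using y e xz K by (auto simp: nbrs_def simple_graph_def)
        ultimately have "?g x - {y} \<subset> ?g y - {x}" by blast
        then have "card (?g x - {y}) < card (?g y - {x})" using fin by (intro psubset_card_mono) auto
        then have "card (?g x) < card (?g y)"
          by (rule card_remove(1)[rotated 2]) (simp_all add: fin nbrs_mem_commute[of x])
        moreover have "?h y - {x} \<subseteq> ?h x - {y}"
          using noE noK K by (auto simp: nbrs_def simple_graph_def)
        then have "card (?h y - {x}) \<le> card (?h x - {y})" using fin by (intro card_mono) auto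
        then have "card (?h y) \<le> card (?h x)"
          by (rule card_remove(2)[rotated 2]) (simp_all add: fin nbrs_mem_commute[of x])
        \<comment> \<open>By \<open>diff\<close> the two counts differ by the same \<open>k\<close>
          at \<open>x\<close> and at \<open>y\<close>, which contradicts these inequalities.\<close>
        ultimately show ?thesis using diff[OF xz(2)] diff[OF yV] by simp
      qed
    qed
  qed
qed

section \<open>Four perfect matchings\<close>

text \<open>A colouring of the edges of the complete graph on \<open>V\<close>: colour \<open>0\<close> is the graph without its
  factors, \<open>1\<close> its complement, \<open>2\<close> the \<open>(k - j)\<close>-factor, and \<open>3, \<dots>, 2 + j\<close> are perfect matchings.\<close>
definition factor_colouring ::
  "'a set \<Rightarrow> ('a \<Rightarrow> nat) \<Rightarrow> ('a \<Rightarrow> nat) \<Rightarrow> nat \<Rightarrow> nat \<Rightarrow> ('a \<Rightarrow> 'a \<Rightarrow> nat) \<Rightarrow> bool" where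
  "factor_colouring V dH dN k j col \<longleftrightarrow> (\<forall>u v. col u v = col v u) \<and>
    (\<forall>u\<in>V. \<forall>v\<in>V. u \<noteq> v \<longrightarrow> col u v < 3 + j) \<and>
    (\<forall>u\<in>V. cdeg V col 0 u = dH u \<and> cdeg V col 1 u = dN u \<and> cdeg V col 2 u = k - j \<and>
      (\<forall>c\<in>{3..<3 + j}. cdeg V col c u = 1))"

text \<open>A perfect matching of colour 2 is given the new colour \<open>3 + j\<close>. The bound
  \<open>j \<le> 3\<close> allows at most three earlier matchings, and \<open>j < k\<close> keeps
  the factor nonempty.\<close>

lemma factor_colouring_step:
  assumes V: "finite V" "even (card V)" and s: "\<And>u. u \<in> V \<Longrightarrow> dH u + dN u = s"
    and j: "j \<le> 3" "j < k" and col: "factor_colouring V dH dN k j col"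
  shows "\<exists>col'. factor_colouring V dH dN k (Suc j) col'"
proof -
  \<comment> \<open>Colours from \<open>3 + j\<close> on do not occur yet and have degree 0.\<close>
  define D where "D c u = (if c = 0 then dH u else if c = 1 then dN u else if c = 2 then k - j
    else if c < 3 + j then 1 else 0)" for c u
  interpret colour_classes V D 0 1 2 "{3..<3 + j}" "k - j" s
    using V s j by unfold_locales (auto simp: D_def)
  have less: "col u v < 3 + j" if "u \<in> V" "v \<in> V" "u \<noteq> v" for u v
    using col that unfolding factor_colouring_def by blast
  have "cdeg V col c u = D c u" if "u \<in> V" for c u
  proof -
    have "{v \<in> V. v \<noteq> u \<and> col u v = c} = {}" if "c \<ge> 3 + j" using less \<open>u \<in> V\<close> that by fastforce
    then have "cdeg V col c u = 0" if "c \<ge> 3 + j" using that unfolding cdeg_def by (metis card.empty)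
    then show ?thesis
      using col that unfolding factor_colouring_def D_def by (auto simp: not_less)
  qed
  moreover have "col u v \<in> {0, 1, 2} \<union> {3..<3 + j}" if "u \<in> V" "v \<in> V" "u \<noteq> v" for u v
    using less[OF that] by auto
  moreover have "\<forall>u v. col u v = col v u" using col unfolding factor_colouring_def by (rule conjunct1)
  ultimately have "colouring col" unfolding colouring_def by simp
  then obtain col1 \<sigma> where col1: "colouring col1" and \<sigma>: "matching_on (\<lambda>u v. col1 u v = 2) V \<sigma>"
    by (rule ex_F_matching)
  have \<sigma>V: "\<sigma> u \<in> V" "\<sigma> u \<noteq> u" "\<sigma> (\<sigma> u) = u" "col1 u (\<sigma> u) = 2" if "u \<in> V" for u
    using \<sigma> that unfolding matching_on_def by auto
  have sym: "col1 u v = col1 v u" for u v using colouring_sym[OF col1] .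
  have deg: "card {v \<in> V. v \<noteq> u \<and> col1 u v = c} = D c u" if "u \<in> V" for c u
    using col1 that unfolding colouring_def cdeg_def by blast
  define col' where "col' u v = (if u \<in> V \<and> v = \<sigma> u then 3 + j else col1 u v)" for u v
  have range: "col1 u v < 3 + j" if "u \<in> V" "v \<in> V" "u \<noteq> v" for u v
  proof -
    have "col1 u v \<in> {0, 1, 2} \<union> {3..<3 + j}"
      using col1 that unfolding colouring_def by blast
    then show ?thesis by auto
  qed
  have sym': "col' u v = col' v u" for u v
    using \<sigma>V sym[of u v] unfolding col'_def by metis
  have range': "col' u v < 3 + Suc j" if "u \<in> V" "v \<in> V" "u \<noteq> v" for u v
    using range[OF that] by (simp add: col'_def)
  have unchanged: "cdeg V col' c u = D c u" if "u \<in> V" "c < 3 + j" "c \<noteq> 2" for c u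
  proof -
    have "{v \<in> V. v \<noteq> u \<and> col' u v = c} = {v \<in> V. v \<noteq> u \<and> col1 u v = c}"
      using that \<sigma>V(4)[OF that(1)] by (auto simp: col'_def)
    then show ?thesis using deg[OF that(1)] by (simp add: cdeg_def)
  qed
  have new: "cdeg V col' (3 + j) u = 1" if "u \<in> V" for u
  proof -
    have "{v \<in> V. v \<noteq> u \<and> col' u v = 3 + j} = {\<sigma> u}"
    proof (intro equalityI subsetI)
      fix v assume "v \<in> {v \<in> V. v \<noteq> u \<and> col' u v = 3 + j}"
      then show "v \<in> {\<sigma> u}" using range[OF that, of v] by (auto simp: col'_def split: if_splits)
    qed (use that \<sigma>V[OF that] in \<open>auto simp: col'_def\<close>)
    then show ?thesis by (simp add: cdeg_def)
  qed
  have "cdeg V col' 2 u = k - Suc j" if "u \<in> V" for u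
  proof -
    have "{v \<in> V. v \<noteq> u \<and> col' u v = 2} = {v \<in> V. v \<noteq> u \<and> col1 u v = 2} - {\<sigma> u}"
      using that by (auto simp: col'_def)
    moreover have "\<sigma> u \<in> {v \<in> V. v \<noteq> u \<and> col1 u v = 2}" using \<sigma>V[OF that] by simp
    ultimately show ?thesis using deg[OF that, of 2] V(1) by (simp add: cdeg_def D_def)
  qed
  moreover have "cdeg V col' c u = 1" if "u \<in> V" "c \<in> {3..<3 + Suc j}" for c u
    using that unchanged[of u c] new[of u] by (cases "c = 3 + j") (auto simp: D_def)
  moreover have "cdeg V col' 0 u = dH u" "cdeg V col' 1 u = dN u" if "u \<in> V" for u
    using that unchanged[of u 0] unchanged[of u 1] by (auto simp: D_def)
  ultimately have "factor_colouring V dH dN k (Suc j) col'"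
    unfolding factor_colouring_def using sym' range' by simp
  then show ?thesis by blast
qed

text \<open>The four steps start from \<open>j = 0, 1, 2, 3\<close>, so the limit of three earlier
  matchings is just respected.\<close>

lemma factor_colouring_four:
  assumes "finite V" "even (card V)" "\<And>u. u \<in> V \<Longrightarrow> dH u + dN u = s" "k \<ge> 4"
    and "factor_colouring V dH dN k 0 col"
  shows "\<exists>col'. factor_colouring V dH dN k 4 col'"
proof -
  have "j \<le> 4 \<Longrightarrow> \<exists>col'. factor_colouring V dH dN k j col'" for j
  proof (induction j)
    case (Suc j)
    then obtain col' where "factor_colouring V dH dN k j col'" by auto
    then show ?case
      using Suc.prems assms(4) by (intro factor_colouring_step[OF assms(1-3)]) auto
  qed (use assms(5) in blast)
  then show ?thesis by blast
qed

section \<open>From colourings back to graphs\<close>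

definition pairs_where :: "'a set \<Rightarrow> ('a \<Rightarrow> 'a \<Rightarrow> bool) \<Rightarrow> 'a set set" where
  "pairs_where V P = {{u, v} | u v. u \<in> V \<and> v \<in> V \<and> u \<noteq> v \<and> P u v}"

lemma simple_graph_pairs_where: "finite V \<Longrightarrow> simple_graph (V, pairs_where V P)"
  by (auto simp: simple_graph_def pairs_where_def)

lemma pairs_where_mono: "(\<And>u v. P u v \<Longrightarrow> Q u v) \<Longrightarrow> pairs_where V P \<subseteq> pairs_where V Q"
  unfolding pairs_where_def by blast

lemma degree_pairs_where:
  assumes "finite V" "v \<in> V" and sym: "\<And>a b. P a b \<longleftrightarrow> P b a"
  shows "degree (V, pairs_where V P) v = card {u \<in> V. u \<noteq> v \<and> P v u}"
proof -
  have "nbrs (pairs_where V P) v = {u \<in> V. u \<noteq> v \<and> P v u}"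
    using assms(2) sym by (auto simp: nbrs_def pairs_where_def doubleton_eq_iff)
  then show ?thesis by (simp add: degree_eq_card_nbrs[OF simple_graph_pairs_where[OF assms(1)]])
qed

theorem theorem1p5:
  fixes k :: nat and ds :: "int list"
  assumes "k \<ge> 4"
    and "\<forall>d \<in> set ds. d \<ge> 0"
    and "even (length ds)"
    and "graphic ds"
    and "graphic (seq_minus ds k)"
  shows "\<exists>(G :: nat ugraph) (F :: nat \<Rightarrow> nat ugraph).
      realizes G ds \<and>
      factor (k - 4) (F 0) G \<and>
      (\<forall>i \<in> {1..4}. factor 1 (F i) G) \<and>
      disjoint_family_on (\<lambda>i. edges (F i)) {0..4}"
proof -
  define V where "V = {..<length ds}"
  have V: "finite V" "even (card V)" using assms(3) by (auto simp: V_def)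
  obtain E0 where E0: "realizes (V, E0) ds"
    using assms(4) unfolding graphic_def realizes_def V_def by (metis prod.collapse)
  obtain K0 where K0: "realizes (V, K0) (seq_minus ds k)"
    using assms(5) unfolding graphic_def realizes_def V_def
    by (metis prod.collapse seq_minus_def length_map)
  have "degree (V, E0) v = degree (V, K0) v + k" if "v \<in> V" for v
  proof -
    have "int (degree (V, E0) v) = ds ! v" using E0 that by (simp add: realizes_def V_def)
    moreover have "int (degree (V, K0) v) = ds ! v - int k"
      using K0 that by (simp add: realizes_def V_def seq_minus_def)
    ultimately show ?thesis by linarith
  qed
  then obtain E K where E: "simple_graph (V, E)" "\<And>v. degree (V, E) v = degree (V, E0) v"
      and K: "simple_graph (V, K)" "\<And>v. degree (V, K) v = degree (V, K0) v" "K \<subseteq> E"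
    using kundu_factor[of V E0 K0 k] E0 K0 unfolding realizes_def by blast
  have degE: "int (card (nbrs E v)) = ds ! v" if "v \<in> V" for v
    using E0 that E by (simp add: realizes_def V_def degree_eq_card_nbrs[symmetric])
  have degK: "int (card (nbrs K v)) = ds ! v - int k" if "v \<in> V" for v
    using K0 that K by (simp add: realizes_def V_def degree_eq_card_nbrs[symmetric] seq_minus_def)
  \<comment> \<open>Kundu's \<open>k\<close>-factor is \<open>E - K\<close>; removing it from the
    graph leaves \<open>K\<close>.\<close>
  define col where "col u v = (if {u, v} \<in> K then 0 else if {u, v} \<notin> E then 1 else 2 :: nat)" for u v
  define dH where "dH v = card (nbrs K v)" for v
  \<comment> \<open>The degree in the complement, out of \<open>card V - 1\<close> other vertices;
    by \<open>leN\<close> the subtraction does not truncate on \<open>V\<close>.\<close>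
  define dN where "dN v = card V - 1 - card (nbrs E v)" for v
  have sub: "nbrs K v \<subseteq> nbrs E v" "nbrs E v \<subseteq> V - {v}" for v
    using K(3) nbrs_subset[OF E(1)] by (auto simp: nbrs_def)
  have finN: "finite (nbrs E v)" "finite (nbrs K v)" for v
    using finite_nbrs[OF E(1)] finite_nbrs[OF K(1)] by auto
  have leN: "card (nbrs E v) \<le> card V - 1" if "v \<in> V" for v
    using card_mono[OF _ sub(2)[of v]] V(1) that by simp
  have card_sum: "card (nbrs E v) = card (nbrs K v) + k" if "v \<in> V" for v
    using degE[OF that] degK[OF that] by linarith
  \<comment> \<open>Graph and complement share all pairs at \<open>v\<close> except the
    \<open>k\<close> in the factor.\<close>
  have s: "dH v + dN v = card V - 1 - k" if "v \<in> V" for v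
    using leN[OF that] card_sum[OF that] by (simp add: dH_def dN_def)
  have "factor_colouring V dH dN k 0 col"
    unfolding factor_colouring_def
  proof (intro conjI ballI allI impI)
    fix u assume u: "u \<in> V"
    have "{v \<in> V. v \<noteq> u \<and> col u v = 0} = nbrs K u"
      using sub[of u] by (auto simp: col_def nbrs_def)
    then show "cdeg V col 0 u = dH u" by (simp add: cdeg_def dH_def)
    have "{v \<in> V. v \<noteq> u \<and> col u v = 1} = (V - {u}) - nbrs E u"
      using K(3) by (auto simp: col_def nbrs_def)
    then show "cdeg V col 1 u = dN u"
      using sub(2)[of u] finN u by (simp add: cdeg_def dN_def card_Diff_subset)
    have "{v \<in> V. v \<noteq> u \<and> col u v = 2} = nbrs E u - nbrs K u"
      using sub[of u] by (auto simp: col_def nbrs_def)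
    then show "cdeg V col 2 u = k - 0"
      using sub(1)[of u] finN card_sum[OF u] by (simp add: cdeg_def card_Diff_subset)
  qed (auto simp: col_def insert_commute)
  then obtain c where c: "factor_colouring V dH dN k 4 c"
    using factor_colouring_four[where dH = dH and dN = dN, OF V s assms(1)] by blast
  then have sym: "c u v = c v u" for u v unfolding factor_colouring_def by blast
  have cdeg: "cdeg V c 1 u = dN u" "cdeg V c 2 u = k - 4" "\<And>i. i \<in> {3..<7} \<Longrightarrow> cdeg V c i u = 1"
    if "u \<in> V" for u using c that unfolding factor_colouring_def by auto
  define G where "G = (V, pairs_where V (\<lambda>u v. c u v \<noteq> 1))"
  \<comment> \<open>Shifted by 2, so that \<open>F 0\<close> is the remaining factor and
    \<open>F 1\<close> to \<open>F 4\<close> are the matchings of colours 3 to 6.\<close>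
  define F where "F i = (V, pairs_where V (\<lambda>u v. c u v = 2 + i))" for i :: nat
  have "degree G u = card (nbrs E u)" if "u \<in> V" for u
  proof -
    have "degree G u = card {v \<in> V. v \<noteq> u \<and> c u v \<noteq> 1}"
      unfolding G_def using V(1) that sym by (intro degree_pairs_where) auto
    also have "{v \<in> V. v \<noteq> u \<and> c u v \<noteq> 1} = (V - {u}) - {v \<in> V. v \<noteq> u \<and> c u v = 1}" by auto
    also have "card \<dots> = card V - 1 - dN u"
      using V(1) that cdeg(1)[OF that] by (subst card_Diff_subset) (auto simp: cdeg_def)
    also have "\<dots> = card (nbrs E u)" using leN[OF that] by (simp add: dN_def)
    finally show ?thesis .
  qed
  then have "realizes G ds"
    using degE V(1) simple_graph_pairs_where[OF V(1)] by (simp add: realizes_def G_def V_def)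
  moreover have F: "factor j (F i) G" if d: "\<And>u. u \<in> V \<Longrightarrow> cdeg V c (2 + i) u = j" for i j
  proof -
    have "degree (F i) u = j" if u: "u \<in> V" for u
    proof -
      have "degree (F i) u = card {v \<in> V. v \<noteq> u \<and> c u v = 2 + i}"
        unfolding F_def using V(1) u sym by (intro degree_pairs_where) auto
      then show ?thesis using d[OF u] by (simp add: cdeg_def)
    qed
    moreover have "edges (F i) \<subseteq> edges G"
      unfolding F_def G_def snd_conv by (rule pairs_where_mono) simp
    ultimately show ?thesis
      using simple_graph_pairs_where[OF V(1)]
      by (simp add: factor_def spanning_subgraph_def regular_def F_def G_def)
  qed
  have "factor (k - 4) (F 0) G" using cdeg(2) by (intro F) simp
  moreover have "\<forall>i\<in>{1..4}. factor 1 (F i) G" using cdeg(3) by (intro ballI F) simp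
  moreover have "disjoint_family_on (\<lambda>i. edges (F i)) {0..4}"
    using sym by (auto simp: disjoint_family_on_def F_def pairs_where_def doubleton_eq_iff)
  ultimately show ?thesis by blast
qed

end
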